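(* Let $Y=\{Y(t),t\in\mathbb{R}^d\}$ be a real-valued measurable centered stationary Gaussian random field with covariance function $C(t)=\mathbf{E}[Y(t)Y(0)]$, $t\in\mathbb{R}^d$, and $\mathbf{E}[Y^2(0)]=1$. Let $f:\mathbb{R}\to\mathbb{R}$ be Borel-measurable, $u\in\mathbb{R}$, $X(t)=f(Y(t))$, $t\in\mathbb{R}^d$, and let $(W_n)_{n\in\mathbb{N}}$ be a van Hove sequence of observation windows in $\mathbb{R}^d$. If $\langle H_1,\mathbf{1}\{f(\cdot)\ge u\}\rangle_\varphi\neq0$ and $$\frac{\int_{\mathbb{R}^d}C^2(t)\,\nu_d(W_n\cap(W_n-t))\,\nu_d(dt)}{\int_{\mathbb{R}^d}C(t)\,\nu_d(W_n\cap(W_n-t))\,\nu_d(dt)}\to0,\quad n\to\infty,$$ then, as $n\to\infty$, $$\frac{\int_{W_n}\mathbf{1}\{X(t)\ge u\}\,dt-\nu_d(W_n)\,\mathbb{P}(X(0)\ge u)}{\langle H_1,\mathbf{1}\{f(\cdot)\ge u\}\rangle_\varphi\sqrt{\int_{\mathbb{R}^d}C(t)\,\nu_d(W_n\cap(W_n-t))\,\nu_d(dt)}}\xrightarrow{d}N(0,1).$$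
   Context: $\nu_d$ is Lebesgue measure on $\mathbb{R}^d$; $\varphi(x)=\frac{1}{\sqrt{2\pi}}e^{-x^2/2}$; $\langle G_1,G_2\rangle_\varphi=\int_{\mathbb{R}}G_1(x)G_2(x)\varphi(x)\,dx$; $H_1(x)=x$. A sequence $(W_n)$ of compact subsets of $\mathbb{R}^d$ is a van Hove sequence if $\nu_d(W_n)\to\infty$ and, for every $r>0$, $\nu_d(\partial W_n\oplus B_r(0))/\nu_d(W_n)\to0$ as $n\to\infty$, where $\partial W_n$ is the boundary, $\oplus$ is the Minkowski sum and $B_r(0)=\{x:\|x\|<r\}$. $\xrightarrow{d}$ denotes convergence in distribution. *)

theory Defs
  imports "HOL-Probability.Probability" "HOL-Library.Set_Algebras"
begin

subsection \<open>Random fields on Euclidean space\<close>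

text \<open>A random field is a function of a point in space and of the outcome in \<^term>\<open>M\<close>;
  measurability is joint measurability in both arguments.\<close>

definition measurable_random_field ::
  "'w measure \<Rightarrow> (real ^ 'd \<Rightarrow> 'w \<Rightarrow> real) \<Rightarrow> bool" where
  "measurable_random_field M Y \<longleftrightarrow>
     (\<lambda>(t, \<omega>). Y t \<omega>) \<in> borel_measurable (borel \<Otimes>\<^sub>M M)"

text \<open>Normal random variables, where the degenerate case of variance \<open>0\<close> is allowed.\<close>

definition gaussian_rv :: "'w measure \<Rightarrow> ('w \<Rightarrow> real) \<Rightarrow> bool" where
  "gaussian_rv M Z \<longleftrightarrow> Z \<in> borel_measurable M \<and>
     (\<exists>\<mu> \<sigma>. (\<sigma> > 0 \<and> distributed M lborel Z (normal_density \<mu> \<sigma>)) \<or>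
            (\<sigma> = 0 \<and> (AE \<omega> in M. Z \<omega> = \<mu>)))"

text \<open>All finite-dimensional distributions are multivariate normal, i.e. every finite
  linear combination of field values is normal.\<close>

definition gaussian_random_field ::
  "'w measure \<Rightarrow> (real ^ 'd \<Rightarrow> 'w \<Rightarrow> real) \<Rightarrow> bool" where
  "gaussian_random_field M Y \<longleftrightarrow>
     (\<forall>T a. finite T \<longrightarrow> gaussian_rv M (\<lambda>\<omega>. \<Sum>t\<in>T. a t * Y t \<omega>))"

definition centered_random_field ::
  "'w measure \<Rightarrow> (real ^ 'd \<Rightarrow> 'w \<Rightarrow> real) \<Rightarrow> bool" where
  "centered_random_field M Y \<longleftrightarrow> (\<forall>t. integrable M (Y t) \<and> (LINT \<omega>|M. Y t \<omega>) = 0)"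

text \<open>Strict stationarity: the finite-dimensional distributions are translation invariant.\<close>

definition stationary_random_field ::
  "'w measure \<Rightarrow> (real ^ 'd \<Rightarrow> 'w \<Rightarrow> real) \<Rightarrow> bool" where
  "stationary_random_field M Y \<longleftrightarrow>
     (\<forall>T h. finite T \<longrightarrow>
        distr M (\<Pi>\<^sub>M t\<in>T. borel) (\<lambda>\<omega>. \<lambda>t\<in>T. Y (t + h) \<omega>) =
        distr M (\<Pi>\<^sub>M t\<in>T. borel) (\<lambda>\<omega>. \<lambda>t\<in>T. Y t \<omega>))"

definition covariance_function ::
  "'w measure \<Rightarrow> (real ^ 'd \<Rightarrow> 'w \<Rightarrow> real) \<Rightarrow> real ^ 'd \<Rightarrow> real" where
  "covariance_function M Y t = (LINT \<omega>|M. Y t \<omega> * Y 0 \<omega>)"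

subsection \<open>Observation windows\<close>

definition van_hove_sequence :: "(nat \<Rightarrow> (real ^ 'd) set) \<Rightarrow> bool" where
  "van_hove_sequence W \<longleftrightarrow>
     (\<forall>n. compact (W n)) \<and>
     filterlim (\<lambda>n. measure lborel (W n)) at_top sequentially \<and>
     (\<forall>r>0. (\<lambda>n. measure lborel (frontier (W n) + ball 0 r) / measure lborel (W n))
              \<longlonglongrightarrow> 0)"

definition set_covariogram :: "(real ^ 'd) set \<Rightarrow> real ^ 'd \<Rightarrow> real" where
  "set_covariogram W t = measure lborel (W \<inter> (\<lambda>x. x - t) ` W)"

subsection \<open>The Gaussian inner product\<close>

definition gauss_inner :: "(real \<Rightarrow> real) \<Rightarrow> (real \<Rightarrow> real) \<Rightarrow> real" where
  "gauss_inner G1 G2 = (LINT x|lborel. G1 x * G2 x * std_normal_density x)"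

definition hermite1 :: "real \<Rightarrow> real" where
  "hermite1 x = x"

end

theory Submission
  imports Defs
begin

text \<open>
  Put \<open>g = indicator {x. f x \<ge> u}\<close>, \<open>p = P(f (Y 0) \<ge> u)\<close> and let \<open>c\<close> be the inner product of \<open>g\<close> with
  the first Hermite polynomial. Then \<open>g x = p + c * x + R x\<close>, where \<open>R\<close> is orthogonal to \<open>1\<close> and \<open>x\<close>
  in \<open>L\<^sup>2\<close> of the standard normal law. Averaging over a window \<open>W\<close> with respect to the uniform law,
  the centred excursion volume divided by the volume of \<open>W\<close> is \<open>c\<close> times the average of \<open>Y\<close> plus the
  average of \<open>R(Y)\<close>.

  \<^item> The linear part is exactly Gaussian (\<open>average_gaussian\<close>): the average of \<open>Y\<close> is an \<open>L\<^sup>2\<close>-limit of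
    finite linear combinations of field values, because well chosen sampling points make the empirical
    mean of \<open>m\<close> values differ from the average by at most \<open>1/m\<close> in mean square
    (\<open>sampling_approximates_average\<close>). Its variance \<open>v\<close> is the average of \<open>C(s - t)\<close> over
    pairs of points of \<open>W\<close>, which by Fubini is the integral of \<open>C\<close> against the set covariogram divided
    by the squared volume (\<open>integral_set_covariogram\<close>).

  \<^item> The nonlinear part is negligible. If \<open>X\<close> and \<open>Y\<close> are standard normal, jointly Gaussian and have
    correlation \<open>\<rho>\<close>, the Hermite expansion gives \<open>E R(X) R(Y) = (\<Sum>k\<ge>2. \<rho>^k * a\<^sub>k)\<close> with
    \<open>a\<^sub>k \<ge> 0\<close> and \<open>(\<Sum>k\<ge>2. a\<^sub>k) = E (R(X))\<^sup>2\<close>, hence \<open>\<bar>E R(X) R(Y)\<bar> \<le> \<rho>\<^sup>2 * E (R(X))\<^sup>2\<close>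
    (\<open>gaussian_correlation_bound\<close>). The variance of the average of \<open>R(Y)\<close> is therefore at most a
    constant times the average of \<open>C(s - t)\<^sup>2\<close> (\<open>average_hermite_rank_2_bound\<close>), and relative to \<open>v\<close> it
    is at most that constant times the ratio assumed to tend to \<open>0\<close>.

  So the characteristic function of the normalised excursion volume at \<open>\<theta>\<close> differs from
  \<open>exp (- \<theta>\<^sup>2 / 2)\<close> by at most \<open>\<bar>\<theta>\<bar>\<close> times the square root of a null sequence, and Levy's continuity
  theorem yields the convergence in distribution.

  The correlation bound is proved first for trigonometric polynomials: there all expectations are
  finite sums of Gaussian characteristic functions, and expanding the mixed factor \<open>exp (\<rho> * \<theta> * \<eta>)\<close>
  into its power series already produces the expansion with nonnegative coefficients. Every
  term of the inequality is continuous in \<open>L\<^sup>2\<close> of the normal law, so it passes to the closure of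
  the trigonometric polynomials, which contains the indicators of all Borel sets and the identity.
\<close>

section \<open>Square-integrable functions\<close>

definition square_integrable :: "'a measure \<Rightarrow> ('a \<Rightarrow> real) \<Rightarrow> bool" where
  "square_integrable M f \<longleftrightarrow> f \<in> borel_measurable M \<and> integrable M (\<lambda>x. (f x)\<^sup>2)"

lemma square_integrable_measurable: "square_integrable M f \<Longrightarrow> f \<in> borel_measurable M"
  and square_integrable_power2: "square_integrable M f \<Longrightarrow> integrable M (\<lambda>x. (f x)\<^sup>2)"
  by (auto simp: square_integrable_def)

lemma square_integrable_mult:
  assumes "square_integrable M f" "square_integrable M g"
  shows "integrable M (\<lambda>x. f x * g x)"
proof (rule Bochner_Integration.integrable_bound)
  show "integrable M (\<lambda>x. (f x)\<^sup>2 + (g x)\<^sup>2)"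
    using assms by (auto simp: square_integrable_def)
  show "(\<lambda>x. f x * g x) \<in> borel_measurable M"
    using assms by (auto simp: square_integrable_def)
  have "\<bar>a * b\<bar> \<le> a\<^sup>2 + b\<^sup>2" for a b :: real
  proof -
    have "2 * (\<bar>a\<bar> * \<bar>b\<bar>) \<le> a\<^sup>2 + b\<^sup>2"
      using sum_squares_bound[of "\<bar>a\<bar>" "\<bar>b\<bar>"] by (simp add: mult.assoc)
    moreover have "0 \<le> \<bar>a\<bar> * \<bar>b\<bar>" by simp
    ultimately show ?thesis unfolding abs_mult by linarith
  qed
  then show "AE x in M. norm (f x * g x) \<le> norm ((f x)\<^sup>2 + (g x)\<^sup>2)"
    by simp
qed

lemma square_integrable_add:
  assumes f: "square_integrable M f" and g: "square_integrable M g"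
  shows "square_integrable M (\<lambda>x. f x + g x)"
proof -
  have "integrable M (\<lambda>x. (f x)\<^sup>2 + (g x)\<^sup>2 + 2 * (f x * g x))"
    using square_integrable_mult[OF f g] square_integrable_power2[OF f] square_integrable_power2[OF g]
    by (intro Bochner_Integration.integrable_add integrable_mult_right)
  moreover have "(\<lambda>x. f x + g x) \<in> borel_measurable M"
    using f g by (intro borel_measurable_add square_integrable_measurable)
  ultimately show ?thesis
    by (simp add: square_integrable_def power2_sum mult.assoc)
qed

lemma square_integrable_cmult:
  "square_integrable M f \<Longrightarrow> square_integrable M (\<lambda>x. c * f x)"
  by (auto simp: square_integrable_def power_mult_distrib)

lemma square_integrable_diff:
  assumes "square_integrable M f" "square_integrable M g"
  shows "square_integrable M (\<lambda>x. f x - g x)"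
  using square_integrable_add[OF assms(1) square_integrable_cmult[OF assms(2), of "-1"]] by simp

lemma square_integrable_sum:
  "(\<And>i. i \<in> I \<Longrightarrow> square_integrable M (f i)) \<Longrightarrow> square_integrable M (\<lambda>x. \<Sum>i\<in>I. f i x)"
proof (induction I rule: infinite_finite_induct)
  case (insert i I)
  then show ?case by (simp add: square_integrable_add)
qed (auto simp: square_integrable_def)

lemma (in finite_measure) square_integrable_bounded:
  assumes "f \<in> borel_measurable M" "\<And>x. \<bar>f x\<bar> \<le> B"
  shows "square_integrable M f"
  unfolding square_integrable_def
proof
  have "(f x)\<^sup>2 \<le> B\<^sup>2" for x
    using power_mono[OF assms(2)[of x], of 2] by simp
  then show "integrable M (\<lambda>x. (f x)\<^sup>2)"
    using assms(1) by (intro integrable_const_bound[of _ "B\<^sup>2"]) auto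
qed (rule assms)

lemma (in finite_measure) square_integrable_const: "square_integrable M (\<lambda>x. c)"
  by (rule square_integrable_bounded[of _ "\<bar>c\<bar>"]) auto

lemma (in finite_measure) square_integrable_integrable:
  "square_integrable M f \<Longrightarrow> integrable M f"
  using square_integrable_mult[OF _ square_integrable_const[of 1]] by fastforce

text \<open>The Cauchy-Schwarz inequality, from the nonnegativity of the quadratic polynomial
  \<open>t \<mapsto> \<integral> (f + t * g)\<^sup>2\<close>.\<close>

lemma integral_mult_power2_le:
  assumes f: "square_integrable M f" and g: "square_integrable M g"
  shows "(\<integral>x. f x * g x \<partial>M)\<^sup>2 \<le> (\<integral>x. (f x)\<^sup>2 \<partial>M) * (\<integral>x. (g x)\<^sup>2 \<partial>M)"
proof -
  define a b c where "a = (\<integral>x. (f x)\<^sup>2 \<partial>M)" and "b = (\<integral>x. f x * g x \<partial>M)" and "c = (\<integral>x. (g x)\<^sup>2 \<partial>M)"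
  have q: "0 \<le> a + 2 * t * b + t\<^sup>2 * c" for t
  proof -
    have "0 \<le> (\<integral>x. (f x + t * g x)\<^sup>2 \<partial>M)" by simp
    also have "\<dots> = (\<integral>x. (f x)\<^sup>2 + 2 * t * (f x * g x) + t\<^sup>2 * (g x)\<^sup>2 \<partial>M)"
      by (intro arg_cong[where f="integral\<^sup>L M"] ext) (auto simp: power2_sum power_mult_distrib)
    also have "\<dots> = a + 2 * t * b + t\<^sup>2 * c"
      using square_integrable_mult[OF f g] square_integrable_power2[OF f] square_integrable_power2[OF g]
      by (simp add: a_def b_def c_def)
    finally show ?thesis .
  qed
  have "0 \<le> c" by (simp add: c_def)
  have "b\<^sup>2 \<le> a * c"
  proof (cases "c = 0")
    case True
    \<comment> \<open>The polynomial is affine; if its slope \<open>2 * b\<close> were nonzero, it would take the value \<open>-1\<close>.\<close>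
    then have "b = 0" using q[of "- (a + 1) / (2 * b)"] by (cases "b = 0") (auto simp: field_simps)
    then show ?thesis using True by simp
  next
    case False
    with \<open>0 \<le> c\<close> have "c > 0" by simp
    \<comment> \<open>The minimiser of the polynomial is \<open>- b / c\<close>.\<close>
    then have "0 \<le> c * (a + 2 * (- b / c) * b + (- b / c)\<^sup>2 * c)"
      using q[of "- b / c"] by simp
    also have "\<dots> = a * c - b\<^sup>2"
      using \<open>c > 0\<close> by (simp add: field_simps power2_eq_square)
    finally show ?thesis by simp
  qed
  then show ?thesis by (simp add: a_def b_def c_def)
qed

lemma abs_integral_mult_le:
  assumes "square_integrable M f" "square_integrable M g"
  shows "\<bar>\<integral>x. f x * g x \<partial>M\<bar> \<le> sqrt (\<integral>x. (f x)\<^sup>2 \<partial>M) * sqrt (\<integral>x. (g x)\<^sup>2 \<partial>M)"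
  using real_sqrt_le_mono[OF integral_mult_power2_le[OF assms]] by (simp add: real_sqrt_mult)

lemma (in prob_space) expectation_abs_le_L2:
  assumes "square_integrable M f"
  shows "(\<integral>x. \<bar>f x\<bar> \<partial>M) \<le> sqrt (\<integral>x. (f x)\<^sup>2 \<partial>M)"
proof -
  have "square_integrable M (\<lambda>x. \<bar>f x\<bar>)"
    using assms by (auto simp: square_integrable_def)
  from abs_integral_mult_le[OF this square_integrable_const[of 1]] show ?thesis
    by (simp add: prob_space)
qed

text \<open>The \<open>L\<^sup>2\<close> inner product is continuous: expand the difference of the products around the limits and
  apply the Cauchy-Schwarz inequality to each term.\<close>

lemma tendsto_integral_mult_L2:
  assumes f: "\<And>n. square_integrable M (f n)" "square_integrable M F"
    and g: "\<And>n. square_integrable M (g n)" "square_integrable M G"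
    and fF: "(\<lambda>n. \<integral>x. (f n x - F x)\<^sup>2 \<partial>M) \<longlonglongrightarrow> 0"
    and gG: "(\<lambda>n. \<integral>x. (g n x - G x)\<^sup>2 \<partial>M) \<longlonglongrightarrow> 0"
  shows "(\<lambda>n. \<integral>x. f n x * g n x \<partial>M) \<longlonglongrightarrow> (\<integral>x. F x * G x \<partial>M)"
proof -
  define df dg where "df = (\<lambda>n x. f n x - F x)" and "dg = (\<lambda>n x. g n x - G x)"
  have df: "square_integrable M (df n)" and dg: "square_integrable M (dg n)" for n
    using f g by (auto simp: df_def dg_def intro: square_integrable_diff)
  let ?N = "\<lambda>h. sqrt (\<integral>x. (h x)\<^sup>2 \<partial>M)"
  have df0: "(\<lambda>n. ?N (df n)) \<longlonglongrightarrow> 0" and dg0: "(\<lambda>n. ?N (dg n)) \<longlonglongrightarrow> 0"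
    using tendsto_real_sqrt[OF fF] tendsto_real_sqrt[OF gG] by (simp_all add: df_def dg_def)
  have eq: "(\<integral>x. f n x * g n x \<partial>M) - (\<integral>x. F x * G x \<partial>M)
     = (\<integral>x. df n x * dg n x \<partial>M) + (\<integral>x. df n x * G x \<partial>M) + (\<integral>x. F x * dg n x \<partial>M)" for n
  proof -
    have "(\<integral>x. f n x * g n x \<partial>M) - (\<integral>x. F x * G x \<partial>M) = (\<integral>x. f n x * g n x - F x * G x \<partial>M)"
      using f g by (intro Bochner_Integration.integral_diff[symmetric] square_integrable_mult) auto
    also have "\<dots> = (\<integral>x. df n x * dg n x + df n x * G x + F x * dg n x \<partial>M)"
      by (intro arg_cong[where f="integral\<^sup>L M"] ext) (simp add: df_def dg_def algebra_simps)
    also have "\<dots> = (\<integral>x. df n x * dg n x \<partial>M) + (\<integral>x. df n x * G x \<partial>M) + (\<integral>x. F x * dg n x \<partial>M)"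
      using df dg f g by (simp add: square_integrable_mult)
    finally show ?thesis .
  qed
  have "(\<lambda>n. (\<integral>x. f n x * g n x \<partial>M) - (\<integral>x. F x * G x \<partial>M)) \<longlonglongrightarrow> 0"
  proof (rule Lim_null_comparison)
    show "\<forall>\<^sub>F n in sequentially. norm ((\<integral>x. f n x * g n x \<partial>M) - (\<integral>x. F x * G x \<partial>M))
        \<le> ?N (df n) * ?N (dg n) + ?N (df n) * ?N G + ?N F * ?N (dg n)"
      unfolding eq
      by (intro always_eventually allI order_trans[OF real_norm_def[THEN eq_refl]]
          order_trans[OF abs_triangle_ineq] add_mono abs_integral_mult_le df dg f g)
    show "(\<lambda>n. ?N (df n) * ?N (dg n) + ?N (df n) * ?N G + ?N F * ?N (dg n)) \<longlonglongrightarrow> 0"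
      by (rule tendsto_eq_intros df0 dg0 refl | simp)+
  qed
  then show ?thesis by (rule LIM_zero_cancel)
qed

lemma tendsto_integral_power2_L2:
  assumes f: "\<And>n. square_integrable M (f n)" "square_integrable M F"
    and fF: "(\<lambda>n. \<integral>x. (f n x - F x)\<^sup>2 \<partial>M) \<longlonglongrightarrow> 0"
  shows "(\<lambda>n. \<integral>x. (f n x)\<^sup>2 \<partial>M) \<longlonglongrightarrow> (\<integral>x. (F x)\<^sup>2 \<partial>M)"
  using tendsto_integral_mult_L2[OF f f fF fF] by (simp add: power2_eq_square)

text \<open>Characteristic functions are stable under small \<open>L\<^sup>2\<close> perturbations, because
  \<open>x \<mapsto> iexp (t * x)\<close> is Lipschitz with constant \<open>\<bar>t\<bar>\<close>.\<close>

lemma (in prob_space) norm_expectation_iexp_diff_le: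
  assumes f: "square_integrable M f" and g: "square_integrable M g"
  shows "norm ((\<integral>x. iexp (t * f x) \<partial>M) - (\<integral>x. iexp (t * g x) \<partial>M))
           \<le> \<bar>t\<bar> * sqrt (\<integral>x. (f x - g x)\<^sup>2 \<partial>M)"
proof -
  have [measurable]: "f \<in> borel_measurable M" "g \<in> borel_measurable M"
    using f g by (auto simp: square_integrable_def)
  have fg: "square_integrable M (\<lambda>x. f x - g x)" by (rule square_integrable_diff[OF f g])
  have i: "integrable M (\<lambda>x. iexp (t * h x))" if [measurable]: "h \<in> borel_measurable M" for h
    by (rule integrable_iexp) auto
  have "norm ((\<integral>x. iexp (t * f x) \<partial>M) - (\<integral>x. iexp (t * g x) \<partial>M))
      = norm (\<integral>x. iexp (t * f x) - iexp (t * g x) \<partial>M)"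
    by (subst Bochner_Integration.integral_diff) (auto intro!: i simp del: of_real_mult)
  also have "\<dots> \<le> (\<integral>x. norm (iexp (t * f x) - iexp (t * g x)) \<partial>M)"
    by (rule integral_norm_bound)
  also have "\<dots> \<le> (\<integral>x. \<bar>t\<bar> * \<bar>f x - g x\<bar> \<partial>M)"
  proof (rule integral_mono)
    show "integrable M (\<lambda>x. norm (iexp (t * f x) - iexp (t * g x)))"
      by (intro integrable_norm Bochner_Integration.integrable_diff i) auto
    show "integrable M (\<lambda>x. \<bar>t\<bar> * \<bar>f x - g x\<bar>)"
      using square_integrable_integrable[OF fg] by simp
    have L: "norm (iexp a - iexp b) \<le> \<bar>a - b\<bar>" for a b :: real
    proof -
      have "iexp a - iexp b = iexp b * (iexp (a - b) - 1)"
        by (simp add: algebra_simps flip: exp_add)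
      then have "norm (iexp a - iexp b) = norm (iexp (a - b) - 1)"
        by (simp only: norm_mult norm_exp_i_times mult_1_left)
      then show ?thesis using iexp_approx1[of "a - b" 0] by simp
    qed
    show "norm (iexp (t * f x) - iexp (t * g x)) \<le> \<bar>t\<bar> * \<bar>f x - g x\<bar>" for x
      using L[of "t * f x" "t * g x"] by (simp add: abs_mult flip: right_diff_distrib)
  qed
  also have "\<dots> \<le> \<bar>t\<bar> * sqrt (\<integral>x. (f x - g x)\<^sup>2 \<partial>M)"
    using expectation_abs_le_L2[OF fg] by (simp add: mult_left_mono)
  finally show ?thesis .
qed

text \<open>Jensen's inequality for the square.\<close>

lemma (in prob_space) integral_power2_ge:
  assumes "square_integrable M f"
  shows "(\<integral>x. f x \<partial>M)\<^sup>2 \<le> (\<integral>x. (f x)\<^sup>2 \<partial>M)"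
  using integral_mult_power2_le[OF assms square_integrable_const[of 1]] by (simp add: prob_space)

section \<open>Averages of second-order processes\<close>

context pair_prob_space
begin

text \<open>Here \<open>t\<close> plays the role of a random location with law \<open>M1\<close> and \<open>M2\<close> is the law of the process.
  The uniform bound on the second moments justifies every exchange of integrals below.\<close>

context
  fixes Z :: "'a \<Rightarrow> 'b \<Rightarrow> real" and K :: real
  assumes Z_measurable [measurable]: "(\<lambda>(t, \<omega>). Z t \<omega>) \<in> borel_measurable (M1 \<Otimes>\<^sub>M M2)"
    and Z_square: "\<And>t. t \<in> space M1 \<Longrightarrow> square_integrable M2 (Z t)"
    and Z_bound: "\<And>t. t \<in> space M1 \<Longrightarrow> (\<integral>\<omega>. (Z t \<omega>)\<^sup>2 \<partial>M2) \<le> K"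
begin

lemma square_integrable_process: "square_integrable (M1 \<Otimes>\<^sub>M M2) (\<lambda>(t, \<omega>). Z t \<omega>)"
proof -
  have "integrable (M1 \<Otimes>\<^sub>M M2) (\<lambda>p. (case p of (t, \<omega>) \<Rightarrow> (Z t \<omega>)\<^sup>2))"
  proof (rule Fubini_integrable)
    show "integrable M1 (\<lambda>t. \<integral>\<omega>. norm (case (t, \<omega>) of (t, \<omega>) \<Rightarrow> (Z t \<omega>)\<^sup>2) \<partial>M2)"
      using Z_bound by (intro M1.integrable_const_bound[of _ K]) (auto intro!: AE_I2)
    show "AE t in M1. integrable M2 (\<lambda>\<omega>. case (t, \<omega>) of (t, \<omega>) \<Rightarrow> (Z t \<omega>)\<^sup>2)"
      using Z_square by (auto intro!: AE_I2 simp: square_integrable_def)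
  qed measurable
  then show ?thesis
    by (auto simp: square_integrable_def case_prod_unfold)
qed

text \<open>For almost every \<open>\<omega>\<close> the path \<open>t \<mapsto> Z t \<omega>\<close> is square-integrable, and then Jensen's inequality bounds
  the squared average by the average of the squares.\<close>

lemma square_integrable_average: "square_integrable M2 (\<lambda>\<omega>. \<integral>t. Z t \<omega> \<partial>M1)"
  unfolding square_integrable_def
proof
  show [measurable]: "(\<lambda>\<omega>. \<integral>t. Z t \<omega> \<partial>M1) \<in> borel_measurable M2"
    by measurable
  have int: "integrable (M1 \<Otimes>\<^sub>M M2) (\<lambda>(t, \<omega>). (Z t \<omega>)\<^sup>2)"
    using square_integrable_process by (auto simp: square_integrable_def case_prod_unfold)
  show "integrable M2 (\<lambda>\<omega>. (\<integral>t. Z t \<omega> \<partial>M1)\<^sup>2)"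
  proof (rule Bochner_Integration.integrable_bound)
    show "integrable M2 (\<lambda>\<omega>. \<integral>t. (Z t \<omega>)\<^sup>2 \<partial>M1)"
      using integrable_snd[OF int] .
    show "AE \<omega> in M2. norm ((\<integral>t. Z t \<omega> \<partial>M1)\<^sup>2) \<le> norm (\<integral>t. (Z t \<omega>)\<^sup>2 \<partial>M1)"
      using AE_integrable_snd[OF int] AE_space
    proof eventually_elim
      case (elim \<omega>)
      then have "square_integrable M1 (\<lambda>t. Z t \<omega>)"
        by (auto simp: square_integrable_def)
      from M1.integral_power2_ge[OF this] show ?case by simp
    qed
  qed measurable
qed

lemma expectation_average_mult:
  assumes B: "square_integrable M2 B"
  shows "(\<integral>\<omega>. (\<integral>t. Z t \<omega> \<partial>M1) * B \<omega> \<partial>M2) = (\<integral>t. (\<integral>\<omega>. Z t \<omega> * B \<omega> \<partial>M2) \<partial>M1)"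
    and "integrable M1 (\<lambda>t. \<integral>\<omega>. Z t \<omega> * B \<omega> \<partial>M2)"
proof -
  have [measurable]: "B \<in> borel_measurable M2" using B by (auto simp: square_integrable_def)
  have "square_integrable (M1 \<Otimes>\<^sub>M M2) (\<lambda>(t, \<omega>). B \<omega>)"
  proof -
    have "integrable (M1 \<Otimes>\<^sub>M M2) (\<lambda>p. (case p of (t, \<omega>) \<Rightarrow> (B \<omega>)\<^sup>2))"
      by (rule Fubini_integrable) (use B in \<open>auto simp: square_integrable_def\<close>)
    then show ?thesis
      by (auto simp: square_integrable_def case_prod_unfold)
  qed
  from square_integrable_mult[OF square_integrable_process this]
  have int: "integrable (M1 \<Otimes>\<^sub>M M2) (\<lambda>(t, \<omega>). Z t \<omega> * B \<omega>)"
    by (simp add: case_prod_unfold)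
  show "(\<integral>\<omega>. (\<integral>t. Z t \<omega> \<partial>M1) * B \<omega> \<partial>M2) = (\<integral>t. (\<integral>\<omega>. Z t \<omega> * B \<omega> \<partial>M2) \<partial>M1)"
    using Fubini_integral[OF int] by simp
  show "integrable M1 (\<lambda>t. \<integral>\<omega>. Z t \<omega> * B \<omega> \<partial>M2)"
    using integrable_fst[OF int] by simp
qed

lemma expectation_average_power2:
  "(\<integral>\<omega>. (\<integral>t. Z t \<omega> \<partial>M1)\<^sup>2 \<partial>M2) = (\<integral>t. (\<integral>s. (\<integral>\<omega>. Z s \<omega> * Z t \<omega> \<partial>M2) \<partial>M1) \<partial>M1)"
proof -
  have "(\<integral>\<omega>. (\<integral>t. Z t \<omega> \<partial>M1)\<^sup>2 \<partial>M2) = (\<integral>t. (\<integral>\<omega>. Z t \<omega> * (\<integral>s. Z s \<omega> \<partial>M1) \<partial>M2) \<partial>M1)"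
    using expectation_average_mult(1)[OF square_integrable_average] by (simp add: power2_eq_square)
  also have "\<dots> = (\<integral>t. (\<integral>s. (\<integral>\<omega>. Z s \<omega> * Z t \<omega> \<partial>M2) \<partial>M1) \<partial>M1)"
    using expectation_average_mult(1)[OF Z_square]
    by (intro Bochner_Integration.integral_cong) (auto simp: mult.commute)
  finally show ?thesis .
qed

text \<open>Independent random sampling points would give a mean square error of at most \<open>m * K\<close> for the sum of
  \<open>m\<close> values. Deterministic points are chosen one after another instead: given the current
  deviation \<open>D\<close>, the error after adding a further point \<open>t\<close>, averaged over \<open>t\<close>, exceeds the previous
  error by at most \<open>K\<close>, so some \<open>t\<close> does at least as well.\<close>

lemma sampling_approximates_average:
  "\<exists>ts. (\<forall>i. ts i \<in> space M1) \<and>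
     (\<integral>\<omega>. ((\<Sum>i<m. Z (ts i) \<omega>) - real m * (\<integral>t. Z t \<omega> \<partial>M1))\<^sup>2 \<partial>M2) \<le> real m * K"
proof (induction m)
  case 0
  obtain t where "t \<in> space M1" using M1.not_empty by auto
  then show ?case by (intro exI[of _ "\<lambda>_. t"]) auto
next
  case (Suc m)
  define A where "A = (\<lambda>\<omega>. \<integral>t. Z t \<omega> \<partial>M1)"
  have A: "square_integrable M2 A" unfolding A_def by (rule square_integrable_average)
  obtain ts where ts: "\<And>i. ts i \<in> space M1"
    and IH: "(\<integral>\<omega>. ((\<Sum>i<m. Z (ts i) \<omega>) - real m * A \<omega>)\<^sup>2 \<partial>M2) \<le> real m * K"
    using Suc.IH by (auto simp: A_def)
  define D where "D = (\<lambda>\<omega>. (\<Sum>i<m. Z (ts i) \<omega>) - real m * A \<omega>)"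
  have D: "square_integrable M2 D"
    unfolding D_def using ts Z_square A
    by (intro square_integrable_diff square_integrable_sum square_integrable_cmult) auto
  have DA: "square_integrable M2 (\<lambda>\<omega>. D \<omega> - A \<omega>)" by (intro square_integrable_diff D A)
  define v where "v = (\<lambda>t. \<integral>\<omega>. (D \<omega> + (Z t \<omega> - A \<omega>))\<^sup>2 \<partial>M2)"
  have v: "v t = (\<integral>\<omega>. (D \<omega> - A \<omega>)\<^sup>2 \<partial>M2) + 2 * (\<integral>\<omega>. Z t \<omega> * (D \<omega> - A \<omega>) \<partial>M2)
      + (\<integral>\<omega>. (Z t \<omega>)\<^sup>2 \<partial>M2)" if "t \<in> space M1" for t
  proof -
    have "v t = (\<integral>\<omega>. (D \<omega> - A \<omega>)\<^sup>2 + 2 * (Z t \<omega> * (D \<omega> - A \<omega>)) + (Z t \<omega>)\<^sup>2 \<partial>M2)"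
      unfolding v_def by (intro arg_cong[where f="integral\<^sup>L M2"] ext) (simp add: power2_eq_square algebra_simps)
    then show ?thesis
      using square_integrable_mult[OF Z_square[OF that] DA] square_integrable_power2[OF DA]
        square_integrable_power2[OF Z_square[OF that]] by simp
  qed
  \<comment> \<open>Otherwise the average of \<open>v\<close> would exceed \<open>m * K + K\<close>. But averaging over \<open>t\<close> turns \<open>Z t\<close> into \<open>A\<close>
    in the cross term, and the terms without \<open>K\<close> add up to \<open>E D\<^sup>2 - E A\<^sup>2\<close>.\<close>
  have "\<exists>t\<in>space M1. v t \<le> real m * K + K"
  proof (rule ccontr)
    assume "\<not> ?thesis"
    then have less: "real m * K + K < v t" if "t \<in> space M1" for t using that by force
    define w where "w = (\<lambda>t. (\<integral>\<omega>. (D \<omega> - A \<omega>)\<^sup>2 \<partial>M2) + 2 * (\<integral>\<omega>. Z t \<omega> * (D \<omega> - A \<omega>) \<partial>M2) + K)"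
    have int_w: "integrable M1 w"
      unfolding w_def using expectation_average_mult(2)[OF DA] by simp
    have w_less: "real m * K + K < w t" if "t \<in> space M1" for t
      using less[OF that] v[OF that] Z_bound[OF that] by (simp add: w_def)
    have "(\<integral>t. real m * K + K \<partial>M1) < (\<integral>t. w t \<partial>M1)"
      using w_less int_w by (intro M1.integral_less_AE_space) (auto intro!: AE_I2 simp: M1.emeasure_space_1)
    moreover have "(\<integral>t. w t \<partial>M1) = (\<integral>\<omega>. (D \<omega> - A \<omega>)\<^sup>2 \<partial>M2) + 2 * (\<integral>\<omega>. A \<omega> * (D \<omega> - A \<omega>) \<partial>M2) + K"
      unfolding w_def A_def using expectation_average_mult[OF DA]
      by (simp add: M1.prob_space A_def)
    moreover have "(\<integral>\<omega>. (D \<omega> - A \<omega>)\<^sup>2 \<partial>M2) + 2 * (\<integral>\<omega>. A \<omega> * (D \<omega> - A \<omega>) \<partial>M2)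
       = (\<integral>\<omega>. (D \<omega>)\<^sup>2 \<partial>M2) - (\<integral>\<omega>. (A \<omega>)\<^sup>2 \<partial>M2)"
    proof -
      have "(\<integral>\<omega>. (D \<omega> - A \<omega>)\<^sup>2 \<partial>M2) + 2 * (\<integral>\<omega>. A \<omega> * (D \<omega> - A \<omega>) \<partial>M2)
         = (\<integral>\<omega>. (D \<omega> - A \<omega>)\<^sup>2 + 2 * (A \<omega> * (D \<omega> - A \<omega>)) \<partial>M2)"
        using square_integrable_mult[OF A DA] square_integrable_power2[OF DA] by simp
      also have "\<dots> = (\<integral>\<omega>. (D \<omega>)\<^sup>2 - (A \<omega>)\<^sup>2 \<partial>M2)"
        by (intro arg_cong[where f="integral\<^sup>L M2"] ext) (simp add: power2_eq_square algebra_simps)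
      also have "\<dots> = (\<integral>\<omega>. (D \<omega>)\<^sup>2 \<partial>M2) - (\<integral>\<omega>. (A \<omega>)\<^sup>2 \<partial>M2)"
        using square_integrable_power2[OF A] square_integrable_power2[OF D] by simp
      finally show ?thesis .
    qed
    moreover have "0 \<le> (\<integral>\<omega>. (A \<omega>)\<^sup>2 \<partial>M2)" by simp
    moreover have "(\<integral>\<omega>. (D \<omega>)\<^sup>2 \<partial>M2) \<le> real m * K" using IH by (simp add: D_def)
    ultimately show False by (simp add: M1.prob_space)
  qed
  then obtain t where t: "t \<in> space M1" "v t \<le> real m * K + K" by blast
  have "(\<integral>\<omega>. ((\<Sum>i<Suc m. Z ((ts(m := t)) i) \<omega>) - real (Suc m) * A \<omega>)\<^sup>2 \<partial>M2) = v t"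
    unfolding v_def D_def
    by (intro arg_cong[where f="integral\<^sup>L M2"] ext arg_cong[where f="\<lambda>x. x\<^sup>2"]) (simp add: algebra_simps)
  then show ?case
    using t ts by (intro exI[of _ "ts(m := t)"]) (auto simp: A_def algebra_simps)
qed

end
end

section \<open>Trigonometric polynomials of jointly Gaussian variables\<close>

text \<open>The functions are real-valued, but complex coefficients keep the expectations of
  their products within reach of characteristic functions.\<close>

definition trig_polynomial :: "(real \<Rightarrow> real) \<Rightarrow> bool" where
  "trig_polynomial p \<longleftrightarrow>
     (\<exists>(T :: real set) c. finite T \<and> (\<forall>x. complex_of_real (p x) = (\<Sum>\<theta>\<in>T. c \<theta> * iexp (\<theta> * x))))"

text \<open>Repeated frequencies may be merged. Sums and products are therefore indexed by disjoint unions and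
  products of the frequency sets.\<close>

lemma trig_polynomialI:
  assumes "finite I" and p: "\<And>x. complex_of_real (p x) = (\<Sum>i\<in>I. c i * iexp (\<theta> i * x))"
  shows "trig_polynomial p"
  unfolding trig_polynomial_def
proof (intro exI conjI allI)
  show "finite (\<theta> ` I)" using assms by simp
  fix x
  have "complex_of_real (p x) = (\<Sum>t\<in>\<theta> ` I. \<Sum>i\<in>{i. i \<in> I \<and> \<theta> i = t}. c i * iexp (\<theta> i * x))"
    unfolding p by (rule sum.image_gen[OF \<open>finite I\<close>])
  also have "\<dots> = (\<Sum>t\<in>\<theta> ` I. (\<Sum>i\<in>{i. i \<in> I \<and> \<theta> i = t}. c i) * iexp (t * x))"
    by (intro sum.cong refl) (simp add: sum_distrib_right)
  finally show "complex_of_real (p x) = (\<Sum>t\<in>\<theta> ` I. (\<Sum>i\<in>{i. i \<in> I \<and> \<theta> i = t}. c i) * iexp (t * x))" .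
qed

lemma trig_polynomial_const: "trig_polynomial (\<lambda>x. a)"
  by (rule trig_polynomialI[of "{()}" _ "\<lambda>_. complex_of_real a" "\<lambda>_. 0"]) auto

lemma trig_polynomial_sin: "trig_polynomial (\<lambda>x. sin (a * x))"
proof (rule trig_polynomialI[of "{True, False}" _ "\<lambda>b. if b then - \<i> / 2 else \<i> / 2" "\<lambda>b. if b then a else - a"])
  fix x
  have "complex_of_real (sin (a * x)) = sin (complex_of_real (a * x))"
    by (simp only: sin_of_real)
  also have "\<dots> = - \<i> / 2 * iexp (a * x) + \<i> / 2 * iexp (- a * x)"
    by (subst sin_exp_eq) (simp add: field_simps)
  finally show "complex_of_real (sin (a * x)) = (\<Sum>b\<in>{True, False}. (if b then - \<i> / 2 else \<i> / 2)
      * iexp ((if b then a else - a) * x))"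
    by simp
qed simp

lemma trig_polynomial_add:
  assumes "trig_polynomial p" "trig_polynomial q"
  shows "trig_polynomial (\<lambda>x. p x + q x)"
proof -
  obtain S c where S: "finite S" "\<And>x. complex_of_real (p x) = (\<Sum>\<theta>\<in>S. c \<theta> * iexp (\<theta> * x))"
    using assms(1) unfolding trig_polynomial_def by metis
  obtain T d where T: "finite T" "\<And>x. complex_of_real (q x) = (\<Sum>\<theta>\<in>T. d \<theta> * iexp (\<theta> * x))"
    using assms(2) unfolding trig_polynomial_def by metis
  show ?thesis
    by (rule trig_polynomialI[of "S <+> T" _ "case_sum c d" "case_sum (\<lambda>x. x) (\<lambda>x. x)"])
       (use S T in \<open>auto simp: sum.Plus\<close>)
qed

lemma trig_polynomial_mult:
  assumes "trig_polynomial p" "trig_polynomial q"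
  shows "trig_polynomial (\<lambda>x. p x * q x)"
proof -
  obtain S c where S: "finite S" "\<And>x. complex_of_real (p x) = (\<Sum>\<theta>\<in>S. c \<theta> * iexp (\<theta> * x))"
    using assms(1) unfolding trig_polynomial_def by metis
  obtain T d where T: "finite T" "\<And>x. complex_of_real (q x) = (\<Sum>\<theta>\<in>T. d \<theta> * iexp (\<theta> * x))"
    using assms(2) unfolding trig_polynomial_def by metis
  show ?thesis
  proof (rule trig_polynomialI[of "S \<times> T" _ "\<lambda>(s, t). c s * d t" "\<lambda>(s, t). s + t"])
    show "finite (S \<times> T)" using S T by simp
    fix x
    have "complex_of_real (p x * q x) = (\<Sum>s\<in>S. c s * iexp (s * x)) * (\<Sum>t\<in>T. d t * iexp (t * x))"
      by (simp only: of_real_mult S T)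
    also have "\<dots> = (\<Sum>(s, t)\<in>S \<times> T. (c s * iexp (s * x)) * (d t * iexp (t * x)))"
      by (simp only: sum_product sum.cartesian_product)
    also have "\<dots> = (\<Sum>i\<in>S \<times> T. (case i of (s, t) \<Rightarrow> c s * d t) * iexp ((case i of (s, t) \<Rightarrow> s + t) * x))"
      by (intro sum.cong refl) (auto simp: algebra_simps simp flip: exp_add)
    finally show "complex_of_real (p x * q x)
        = (\<Sum>i\<in>S \<times> T. (case i of (s, t) \<Rightarrow> c s * d t) * iexp ((case i of (s, t) \<Rightarrow> s + t) * x))" .
  qed
qed

lemma trig_polynomial_cmult: "trig_polynomial p \<Longrightarrow> trig_polynomial (\<lambda>x. a * p x)"
  using trig_polynomial_mult[OF trig_polynomial_const] .

text \<open>Ordinary polynomials of trigonometric polynomials are trigonometric; the approximation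
  theorem of Weierstrass then gives access to continuous functions of \<open>sin (a * x)\<close>.\<close>

lemma trig_polynomial_compose:
  fixes g :: "real \<Rightarrow> real"
  assumes "real_polynomial_function g" "trig_polynomial p"
  shows "trig_polynomial (\<lambda>x. g (p x))"
  using assms(1)
proof induction
  case (linear g)
  have "g (p x) = g 1 * p x" for x
    using linear_cmul[OF bounded_linear.linear[OF linear], of "p x" 1] by simp
  then show ?case
    using trig_polynomial_cmult[OF assms(2), of "g 1"] by presburger
next
  case (const c)
  show ?case by (rule trig_polynomial_const)
next
  case (add g h)
  then show ?case by (intro trig_polynomial_add)
next
  case (mult g h)
  then show ?case by (intro trig_polynomial_mult)
qed

lemma trig_polynomial_continuous:
  assumes "trig_polynomial p"
  shows "continuous_on UNIV p"
proof -
  obtain T c where T: "\<And>x. complex_of_real (p x) = (\<Sum>\<theta>\<in>T. c \<theta> * iexp (\<theta> * x))"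
    using assms unfolding trig_polynomial_def by metis
  have "p = (\<lambda>x. Re (\<Sum>\<theta>\<in>T. c \<theta> * iexp (\<theta> * x)))"
    by (rule ext) (simp only: T[symmetric] Re_complex_of_real)
  moreover have "continuous_on UNIV (\<lambda>x. Re (\<Sum>\<theta>\<in>T. c \<theta> * iexp (\<theta> * x)))"
    by (intro continuous_intros)
  ultimately show ?thesis by metis
qed

lemma trig_polynomial_bounded:
  assumes "trig_polynomial p"
  shows "\<exists>B. \<forall>x. \<bar>p x\<bar> \<le> B"
proof -
  obtain T c where T: "\<And>x. complex_of_real (p x) = (\<Sum>\<theta>\<in>T. c \<theta> * iexp (\<theta> * x))"
    using assms unfolding trig_polynomial_def by metis
  have "\<bar>p x\<bar> \<le> (\<Sum>\<theta>\<in>T. norm (c \<theta>))" for x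
  proof -
    have "\<bar>p x\<bar> = norm (complex_of_real (p x))" by simp
    also have "\<dots> \<le> (\<Sum>\<theta>\<in>T. norm (c \<theta> * iexp (\<theta> * x)))"
      unfolding T by (rule norm_sum)
    also have "\<dots> = (\<Sum>\<theta>\<in>T. norm (c \<theta>))"
      by (simp only: norm_mult norm_exp_i_times mult_1_right)
    finally show ?thesis .
  qed
  then show ?thesis by blast
qed

lemma (in finite_measure) trig_polynomial_square_integrable:
  assumes "trig_polynomial p" "X \<in> borel_measurable M"
  shows "square_integrable M (\<lambda>\<omega>. p (X \<omega>))"
proof -
  obtain B where "\<And>x. \<bar>p x\<bar> \<le> B" using trig_polynomial_bounded[OF assms(1)] by blast
  moreover have "p \<in> borel_measurable borel"
    by (rule borel_measurable_continuous_onI[OF trig_polynomial_continuous[OF assms(1)]])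
  ultimately show ?thesis
    using assms(2) by (intro square_integrable_bounded[of _ B]) auto
qed

text \<open>Up to the factor \<open>\<i>^k\<close> this is the inner product, under the standard normal law, of the
  trigonometric polynomial with coefficients \<open>c\<close> and the \<open>k\<close>-th Hermite polynomial, since
  \<open>E (iexp (\<theta> * Z) * He\<^sub>k(Z)) = (\<i> * \<theta>)^k * exp (- \<theta>\<^sup>2 / 2)\<close> for a standard normal \<open>Z\<close>.\<close>

definition hermite_coeff :: "real set \<Rightarrow> (real \<Rightarrow> complex) \<Rightarrow> nat \<Rightarrow> complex" where
  "hermite_coeff T c k = (\<Sum>\<theta>\<in>T. c \<theta> * exp (- \<theta>\<^sup>2 / 2) * \<theta> ^ k)"

text \<open>The joint law is described by its characteristic function, which is what the linear combinations of
  a Gaussian field determine directly. Unlike a bivariate density, it also covers \<open>\<rho> = 1\<close>.\<close>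

definition (in prob_space) correlated_std_normal :: "real \<Rightarrow> ('a \<Rightarrow> real) \<Rightarrow> ('a \<Rightarrow> real) \<Rightarrow> bool" where
  "correlated_std_normal \<rho> X Y \<longleftrightarrow> X \<in> borel_measurable M \<and> Y \<in> borel_measurable M \<and>
     (\<forall>a b. (\<integral>\<omega>. iexp (a * X \<omega> + b * Y \<omega>) \<partial>M) = exp (- (a\<^sup>2 + 2 * \<rho> * a * b + b\<^sup>2) / 2))"

text \<open>The Hermite expansion of the correlation. Replace the second factor by its complex conjugate, so
  that the expectation is a double sum over \<open>\<theta>\<close> and \<open>\<eta>\<close> with the Gaussian factor
  \<open>exp (- \<theta>\<^sup>2 / 2) * exp (- \<eta>\<^sup>2 / 2) * exp (\<rho> * \<theta> * \<eta>)\<close>. In the \<open>k\<close>-th term of the series of the last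
  exponential the double sum factors into a number and its conjugate, whence the squared modulus.\<close>

lemma (in prob_space) trig_polynomial_correlation_sums:
  assumes XY: "correlated_std_normal \<rho> X Y"
    and T: "finite T" "\<And>x. complex_of_real (p x) = (\<Sum>\<theta>\<in>T. c \<theta> * iexp (\<theta> * x))"
  shows "(\<lambda>k. \<rho> ^ k * ((cmod (hermite_coeff T c k))\<^sup>2 / fact k)) sums (\<integral>\<omega>. p (X \<omega>) * p (Y \<omega>) \<partial>M)"
proof -
  have [measurable]: "X \<in> borel_measurable M" "Y \<in> borel_measurable M"
    and ch: "\<And>a b. (\<integral>\<omega>. iexp (a * X \<omega> + b * Y \<omega>) \<partial>M) = exp (- (a\<^sup>2 + 2 * \<rho> * a * b + b\<^sup>2) / 2)"
    using XY by (auto simp: correlated_std_normal_def)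
  define d where "d \<theta> = c \<theta> * exp (- \<theta>\<^sup>2 / 2)" for \<theta> :: real
  have cnj_p: "complex_of_real (p x) = (\<Sum>\<theta>\<in>T. cnj (c \<theta>) * iexp (- \<theta> * x))" for x
  proof -
    have "complex_of_real (p x) = cnj (complex_of_real (p x))" by simp
    also have "\<dots> = (\<Sum>\<theta>\<in>T. cnj (c \<theta>) * iexp (- \<theta> * x))"
      unfolding T by (simp add: exp_cnj)
    finally show ?thesis .
  qed
  have "complex_of_real (\<integral>\<omega>. p (X \<omega>) * p (Y \<omega>) \<partial>M) = (\<integral>\<omega>. complex_of_real (p (X \<omega>) * p (Y \<omega>)) \<partial>M)"
    by (simp del: of_real_mult)
  also have "\<dots> = (\<integral>\<omega>. (\<Sum>\<theta>\<in>T. \<Sum>\<eta>\<in>T. c \<theta> * cnj (c \<eta>) * iexp (\<theta> * X \<omega> + (- \<eta>) * Y \<omega>)) \<partial>M)"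
  proof (intro Bochner_Integration.integral_cong refl)
    fix \<omega>
    have "complex_of_real (p (X \<omega>) * p (Y \<omega>))
        = (\<Sum>\<theta>\<in>T. c \<theta> * iexp (\<theta> * X \<omega>)) * (\<Sum>\<eta>\<in>T. cnj (c \<eta>) * iexp (- \<eta> * Y \<omega>))"
      by (simp only: of_real_mult T(2)[of "X \<omega>"] cnj_p[of "Y \<omega>"])
    also have "\<dots> = (\<Sum>\<theta>\<in>T. \<Sum>\<eta>\<in>T. c \<theta> * cnj (c \<eta>) * iexp (\<theta> * X \<omega> + (- \<eta>) * Y \<omega>))"
      unfolding sum_product
      by (intro sum.cong refl) (simp only: of_real_add distrib_left exp_add mult_ac)
    finally show "complex_of_real (p (X \<omega>) * p (Y \<omega>)) = \<dots>" .
  qed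
  also have "\<dots> = (\<Sum>\<theta>\<in>T. \<Sum>\<eta>\<in>T. c \<theta> * cnj (c \<eta>) * (\<integral>\<omega>. iexp (\<theta> * X \<omega> + (- \<eta>) * Y \<omega>) \<partial>M))"
  proof -
    have i: "integrable M (\<lambda>\<omega>. iexp (\<theta> * X \<omega> + (- \<eta>) * Y \<omega>))" for \<theta> \<eta>
      by (rule integrable_iexp) auto
    have "(\<integral>\<omega>. (\<Sum>\<theta>\<in>T. \<Sum>\<eta>\<in>T. c \<theta> * cnj (c \<eta>) * iexp (\<theta> * X \<omega> + (- \<eta>) * Y \<omega>)) \<partial>M)
        = (\<Sum>\<theta>\<in>T. (\<integral>\<omega>. (\<Sum>\<eta>\<in>T. c \<theta> * cnj (c \<eta>) * iexp (\<theta> * X \<omega> + (- \<eta>) * Y \<omega>)) \<partial>M))"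
      by (intro Bochner_Integration.integral_sum Bochner_Integration.integrable_sum integrable_mult_right i)
    also have "\<dots> = (\<Sum>\<theta>\<in>T. \<Sum>\<eta>\<in>T. (\<integral>\<omega>. c \<theta> * cnj (c \<eta>) * iexp (\<theta> * X \<omega> + (- \<eta>) * Y \<omega>) \<partial>M))"
      by (intro sum.cong refl Bochner_Integration.integral_sum integrable_mult_right i)
    finally show ?thesis
      by (simp only: integral_mult_right_zero)
  qed
  also have "\<dots> = (\<Sum>\<theta>\<in>T. \<Sum>\<eta>\<in>T. d \<theta> * cnj (d \<eta>) * complex_of_real (exp (\<rho> * \<theta> * \<eta>)))"
    unfolding ch d_def
  proof (intro sum.cong refl)
    fix \<theta> \<eta> :: real
    have "exp (- (\<theta>\<^sup>2 + 2 * \<rho> * \<theta> * - \<eta> + (- \<eta>)\<^sup>2) / 2) = exp (- \<theta>\<^sup>2 / 2) * exp (- \<eta>\<^sup>2 / 2) * exp (\<rho> * \<theta> * \<eta>)"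
      by (simp flip: exp_add)
    then show "c \<theta> * cnj (c \<eta>) * complex_of_real (exp (- (\<theta>\<^sup>2 + 2 * \<rho> * \<theta> * - \<eta> + (- \<eta>)\<^sup>2) / 2))
        = c \<theta> * exp (- \<theta>\<^sup>2 / 2) * cnj (c \<eta> * exp (- \<eta>\<^sup>2 / 2)) * complex_of_real (exp (\<rho> * \<theta> * \<eta>))"
      by (simp only: of_real_mult complex_cnj_mult complex_cnj_complex_of_real mult_ac)
  qed
  finally have eq: "complex_of_real (\<integral>\<omega>. p (X \<omega>) * p (Y \<omega>) \<partial>M)
     = (\<Sum>\<theta>\<in>T. \<Sum>\<eta>\<in>T. d \<theta> * cnj (d \<eta>) * complex_of_real (exp (\<rho> * \<theta> * \<eta>)))" .
  have "(\<lambda>k. \<Sum>\<theta>\<in>T. \<Sum>\<eta>\<in>T. d \<theta> * cnj (d \<eta>) * complex_of_real ((\<rho> * \<theta> * \<eta>) ^ k /\<^sub>R fact k))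
     sums complex_of_real (\<integral>\<omega>. p (X \<omega>) * p (Y \<omega>) \<partial>M)"
    unfolding eq by (intro sums_sum sums_mult sums_of_real exp_converges)
  moreover have "(\<Sum>\<theta>\<in>T. \<Sum>\<eta>\<in>T. d \<theta> * cnj (d \<eta>) * complex_of_real ((\<rho> * \<theta> * \<eta>) ^ k /\<^sub>R fact k))
     = complex_of_real (\<rho> ^ k * ((cmod (hermite_coeff T c k))\<^sup>2 / fact k))" for k
  proof -
    have G: "hermite_coeff T c k = (\<Sum>\<theta>\<in>T. d \<theta> * \<theta> ^ k)"
      by (simp add: hermite_coeff_def d_def)
    have "complex_of_real ((cmod (hermite_coeff T c k))\<^sup>2)
        = (\<Sum>\<theta>\<in>T. d \<theta> * \<theta> ^ k) * (\<Sum>\<eta>\<in>T. cnj (d \<eta>) * \<eta> ^ k)"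
      unfolding complex_norm_square G by simp
    also have "\<dots> = (\<Sum>\<theta>\<in>T. \<Sum>\<eta>\<in>T. (d \<theta> * \<theta> ^ k) * (cnj (d \<eta>) * \<eta> ^ k))"
      by (rule sum_product)
    finally have *: "complex_of_real ((cmod (hermite_coeff T c k))\<^sup>2)
        = (\<Sum>\<theta>\<in>T. \<Sum>\<eta>\<in>T. (d \<theta> * \<theta> ^ k) * (cnj (d \<eta>) * \<eta> ^ k))" .
    have "complex_of_real (\<rho> ^ k * ((cmod (hermite_coeff T c k))\<^sup>2 / fact k))
        = of_real (\<rho> ^ k / fact k) * complex_of_real ((cmod (hermite_coeff T c k))\<^sup>2)"
      by simp
    also have "\<dots> = (\<Sum>\<theta>\<in>T. \<Sum>\<eta>\<in>T. d \<theta> * cnj (d \<eta>) * complex_of_real ((\<rho> * \<theta> * \<eta>) ^ k /\<^sub>R fact k))"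
      unfolding * sum_distrib_left
      by (intro sum.cong refl) (simp add: power_mult_distrib scaleR_conv_of_real field_simps)
    finally show ?thesis by simp
  qed
  ultimately show ?thesis
    by (simp only: sums_of_real_iff)
qed

lemma prob_space_std_normal: "prob_space std_normal_distribution"
  by (rule prob_space_normal_density) simp

interpretation std_normal: prob_space std_normal_distribution
  by (rule prob_space_std_normal)

lemma std_normal_iexp: "(\<integral>x. iexp (t * x) \<partial>std_normal_distribution) = complex_of_real (exp (- t\<^sup>2 / 2))"
  using char_std_normal_distribution by (metis char_def)

text \<open>A standard normal variable paired with itself is the case of correlation \<open>1\<close>; it identifies the
  sum of the coefficients of the expansion with a second moment.\<close>

lemma std_normal_correlated_self:
  "std_normal.correlated_std_normal 1 (\<lambda>x. x) (\<lambda>x. x)"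
proof -
  have "(\<integral>x. iexp (a * x + b * x) \<partial>std_normal_distribution) = exp (- (a\<^sup>2 + 2 * 1 * a * b + b\<^sup>2) / 2)" for a b
    using std_normal_iexp[of "a + b"] by (simp add: power2_sum algebra_simps)
  then show ?thesis by (simp add: std_normal.correlated_std_normal_def)
qed

lemma square_integrable_std_normal_id: "square_integrable std_normal_distribution (\<lambda>x. x)"
  using integrable_std_normal_moment[of 2]
  by (simp add: square_integrable_def integrable_density)

lemma DERIV_sequentially:
  fixes f :: "real \<Rightarrow> real"
  assumes "(f has_real_derivative D) (at t)" "c \<noteq> 0"
  shows "(\<lambda>n. (f (t + c / real (Suc n)) - f t) / (c / real (Suc n))) \<longlonglongrightarrow> D"
proof -
  have "(\<lambda>n. c / real (Suc n)) \<longlonglongrightarrow> 0"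
    using tendsto_mult[OF tendsto_const[of c] LIMSEQ_inverse_real_of_nat] by (simp add: divide_inverse)
  with assms(2) have "filterlim (\<lambda>n. c / real (Suc n)) (at 0) sequentially"
    by (auto simp: filterlim_at)
  from filterlim_compose[OF assms(1)[unfolded DERIV_def] this] show ?thesis by simp
qed

text \<open>The trigonometric polynomials \<open>n * sin (x / n)\<close> converge to \<open>x\<close> and are dominated by \<open>\<bar>x\<bar>\<close>. They are
  the bridge between bounded periodic functions and functions on the line.\<close>

lemma scaled_sin_tendsto: "(\<lambda>n. real (Suc n) * sin (1 / real (Suc n) * x)) \<longlonglongrightarrow> x"
proof -
  have "((\<lambda>s. sin (s * x)) has_real_derivative x) (at 0)"
    by (auto intro!: derivative_eq_intros)
  from DERIV_sequentially[OF this, of 1] show ?thesis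
    by (simp add: mult.commute)
qed

lemma scaled_sin_le: "\<bar>real (Suc n) * sin (1 / real (Suc n) * x)\<bar> \<le> \<bar>x\<bar>"
proof -
  have "\<bar>sin (1 / real (Suc n) * x)\<bar> \<le> \<bar>1 / real (Suc n) * x\<bar>"
    by (rule abs_sin_x_le_abs_x)
  then have "\<bar>real (Suc n)\<bar> * \<bar>sin (1 / real (Suc n) * x)\<bar> \<le> \<bar>real (Suc n)\<bar> * \<bar>1 / real (Suc n) * x\<bar>"
    by (intro mult_left_mono) auto
  also have "\<dots> = \<bar>x\<bar>" by (simp add: abs_mult)
  finally show ?thesis unfolding abs_mult .
qed

text \<open>Replacing \<open>x\<close> by \<open>n * sin (x / n)\<close> turns the left-hand side, up to a constant factor, into a symmetric
  difference quotient of the characteristic function \<open>exp (- t\<^sup>2 / 2)\<close>; let \<open>n\<close> tend to infinity.\<close>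

lemma std_normal_mult_iexp:
  "(\<integral>x. complex_of_real x * iexp (t * x) \<partial>std_normal_distribution) = \<i> * t * exp (- t\<^sup>2 / 2)"
proof (rule LIMSEQ_unique)
  let ?s = "\<lambda>n x. complex_of_real (real (Suc n) * sin (1 / real (Suc n) * x)) * iexp (t * x)"
  show "(\<lambda>n. \<integral>x. ?s n x \<partial>std_normal_distribution)
      \<longlonglongrightarrow> (\<integral>x. complex_of_real x * iexp (t * x) \<partial>std_normal_distribution)"
  proof (rule integral_dominated_convergence[where w="\<lambda>x. \<bar>x\<bar>"])
    show "integrable std_normal_distribution (\<lambda>x. \<bar>x\<bar>)"
      using std_normal.square_integrable_integrable[OF square_integrable_std_normal_id] by simp
    show "AE x in std_normal_distribution. (\<lambda>n. ?s n x) \<longlonglongrightarrow> complex_of_real x * iexp (t * x)"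
      by (intro AE_I2 tendsto_mult tendsto_of_real scaled_sin_tendsto tendsto_const)
    show "AE x in std_normal_distribution. norm (?s n x) \<le> \<bar>x\<bar>" for n
    proof (rule AE_I2)
      fix x
      have "norm (?s n x) = \<bar>real (Suc n) * sin (1 / real (Suc n) * x)\<bar>"
        by (simp only: norm_mult norm_exp_i_times norm_of_real mult_1_right)
      then show "norm (?s n x) \<le> \<bar>x\<bar>" using scaled_sin_le[of n x] by simp
    qed
  qed measurable
  let ?r = "\<lambda>n. real (Suc n) / 2 * (exp (- (t - 1 / real (Suc n))\<^sup>2 / 2) - exp (- (t + 1 / real (Suc n))\<^sup>2 / 2))"
  have "(\<integral>x. ?s n x \<partial>std_normal_distribution) = \<i> * complex_of_real (?r n)" for n
  proof -
    let ?h = "1 / real (Suc n)"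
    have "?s n x = \<i> * (real (Suc n) / 2) * iexp ((t - ?h) * x) - \<i> * (real (Suc n) / 2) * iexp ((t + ?h) * x)" for x
    proof -
      have "complex_of_real (sin (?h * x)) = (iexp (?h * x) - iexp (- ?h * x)) / (2 * \<i>)"
        by (subst sin_of_real[symmetric], subst sin_exp_eq) simp
      then have "?s n x = real (Suc n) * ((iexp (?h * x) - iexp (- ?h * x)) / (2 * \<i>)) * iexp (t * x)"
        by (simp only: of_real_mult)
      also have "\<dots> = \<i> * (real (Suc n) / 2) * (iexp (- ?h * x) * iexp (t * x))
                   - \<i> * (real (Suc n) / 2) * (iexp (?h * x) * iexp (t * x))"
        by (simp add: field_simps)
      also have "iexp (- ?h * x) * iexp (t * x) = iexp ((t - ?h) * x)"
        by (simp only: exp_add[symmetric] distrib_left[symmetric] of_real_add[symmetric])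
           (simp add: algebra_simps)
      also have "iexp (?h * x) * iexp (t * x) = iexp ((t + ?h) * x)"
        by (simp only: exp_add[symmetric] distrib_left[symmetric] of_real_add[symmetric])
           (simp add: algebra_simps)
      finally show ?thesis .
    qed
    moreover have i: "integrable std_normal_distribution (\<lambda>x. iexp (a * x))" for a :: real
      by (rule std_normal.integrable_iexp) auto
    ultimately have "(\<integral>x. ?s n x \<partial>std_normal_distribution)
       = \<i> * (real (Suc n) / 2) * (\<integral>x. iexp ((t - ?h) * x) \<partial>std_normal_distribution)
       - \<i> * (real (Suc n) / 2) * (\<integral>x. iexp ((t + ?h) * x) \<partial>std_normal_distribution)"
      by (simp only: Bochner_Integration.integral_diff integral_mult_right_zero integrable_mult_right i)
    then show ?thesis
      unfolding std_normal_iexp by (simp add: algebra_simps)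
  qed
  moreover have "?r \<longlonglongrightarrow> t * exp (- t\<^sup>2 / 2)"
  proof -
    define F :: "real \<Rightarrow> real" where "F s = exp (- s\<^sup>2 / 2)" for s
    have D: "(F has_real_derivative (- t * exp (- t\<^sup>2 / 2))) (at t)"
      unfolding F_def by (auto intro!: derivative_eq_intros)
    have "(\<lambda>n. - ((F (t + 1 / real (Suc n)) - F t) / (1 / real (Suc n))
              + (F (t + (-1) / real (Suc n)) - F t) / ((-1) / real (Suc n))) / 2)
       \<longlonglongrightarrow> - (- t * exp (- t\<^sup>2 / 2) + - t * exp (- t\<^sup>2 / 2)) / 2"
      by (intro tendsto_intros DERIV_sequentially[OF D]) auto
    also have "(\<lambda>n. - ((F (t + 1 / real (Suc n)) - F t) / (1 / real (Suc n))
              + (F (t + (-1) / real (Suc n)) - F t) / ((-1) / real (Suc n))) / 2)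
        = (\<lambda>n. real (Suc n) / 2 * (F (t - 1 / real (Suc n)) - F (t + 1 / real (Suc n))))"
      by (rule ext) (simp del: of_nat_Suc add: field_simps)
    finally show ?thesis unfolding F_def by simp
  qed
  ultimately show "(\<lambda>n. \<integral>x. ?s n x \<partial>std_normal_distribution) \<longlonglongrightarrow> \<i> * t * exp (- t\<^sup>2 / 2)"
    using tendsto_mult[OF tendsto_const[of \<i>] tendsto_of_real, of ?r "t * exp (- t\<^sup>2 / 2)"]
    by (simp only: of_real_mult[of t] mult.assoc)
qed

lemma hermite_coeff_0:
  assumes T: "finite T" "\<And>x. complex_of_real (p x) = (\<Sum>\<theta>\<in>T. c \<theta> * iexp (\<theta> * x))"
  shows "hermite_coeff T c 0 = (\<integral>x. p x \<partial>std_normal_distribution)"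
proof -
  have i: "integrable std_normal_distribution (\<lambda>x. iexp (a * x))" for a :: real
    by (rule std_normal.integrable_iexp) auto
  have "complex_of_real (\<integral>x. p x \<partial>std_normal_distribution) = (\<integral>x. complex_of_real (p x) \<partial>std_normal_distribution)"
    by simp
  also have "\<dots> = (\<Sum>\<theta>\<in>T. c \<theta> * (\<integral>x. iexp (\<theta> * x) \<partial>std_normal_distribution))"
    unfolding T(2) by (subst Bochner_Integration.integral_sum) (auto intro!: i integrable_mult_right simp del: of_real_mult)
  finally show ?thesis
    unfolding std_normal_iexp by (simp add: hermite_coeff_def)
qed

lemma hermite_coeff_1:
  assumes T: "finite T" "\<And>x. complex_of_real (p x) = (\<Sum>\<theta>\<in>T. c \<theta> * iexp (\<theta> * x))"
  shows "\<i> * hermite_coeff T c 1 = (\<integral>x. x * p x \<partial>std_normal_distribution)"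
proof -
  have i: "integrable std_normal_distribution (\<lambda>x. complex_of_real x * iexp (a * x))" for a :: real
  proof (rule Bochner_Integration.integrable_bound)
    show "integrable std_normal_distribution (\<lambda>x. \<bar>x\<bar>)"
      using std_normal.square_integrable_integrable[OF square_integrable_std_normal_id] by simp
    show "AE x in std_normal_distribution. norm (complex_of_real x * iexp (a * x)) \<le> norm \<bar>x\<bar>"
      by (simp add: norm_mult del: of_real_mult)
  qed measurable
  have "complex_of_real (\<integral>x. x * p x \<partial>std_normal_distribution)
      = (\<integral>x. complex_of_real (x * p x) \<partial>std_normal_distribution)"
    by (simp del: of_real_mult)
  also have "\<dots> = (\<integral>x. (\<Sum>\<theta>\<in>T. c \<theta> * (complex_of_real x * iexp (\<theta> * x))) \<partial>std_normal_distribution)"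
    by (intro Bochner_Integration.integral_cong refl)
       (simp only: of_real_mult[of _ "p _"] T(2) sum_distrib_left mult_ac)
  also have "\<dots> = (\<Sum>\<theta>\<in>T. c \<theta> * (\<integral>x. complex_of_real x * iexp (\<theta> * x) \<partial>std_normal_distribution))"
    by (subst Bochner_Integration.integral_sum) (auto intro!: i integrable_mult_right simp del: of_real_mult)
  finally show ?thesis
    unfolding std_normal_mult_iexp by (simp add: hermite_coeff_def sum_distrib_left mult_ac)
qed

text \<open>The terms \<open>k = 0\<close> and \<open>k = 1\<close> of the expansion are the two subtracted squares. All coefficients are
  nonnegative, so the remainder is at most \<open>\<rho>\<^sup>2\<close> times its value at \<open>\<rho> = 1\<close>.\<close>

lemma (in prob_space) trig_polynomial_correlation_bound:
  assumes XY: "correlated_std_normal \<rho> X Y" and \<rho>: "\<bar>\<rho>\<bar> \<le> 1" and p: "trig_polynomial p"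
  shows "\<bar>(\<integral>\<omega>. p (X \<omega>) * p (Y \<omega>) \<partial>M) - (\<integral>x. p x \<partial>std_normal_distribution)\<^sup>2
            - \<rho> * (\<integral>x. x * p x \<partial>std_normal_distribution)\<^sup>2\<bar>
          \<le> \<rho>\<^sup>2 * (\<integral>x. (p x)\<^sup>2 \<partial>std_normal_distribution)"
proof -
  obtain T c where T: "finite T" "\<And>x. complex_of_real (p x) = (\<Sum>\<theta>\<in>T. c \<theta> * iexp (\<theta> * x))"
    using p unfolding trig_polynomial_def by metis
  define a where "a k = (cmod (hermite_coeff T c k))\<^sup>2 / fact k" for k
  have a_nonneg: "0 \<le> a k" for k by (simp add: a_def)
  have a0: "a 0 = (\<integral>x. p x \<partial>std_normal_distribution)\<^sup>2"
    by (simp add: a_def hermite_coeff_0[OF T])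
  have "(cmod (hermite_coeff T c 1))\<^sup>2 = (cmod (\<i> * hermite_coeff T c 1))\<^sup>2"
    by (simp add: norm_mult)
  then have a1: "a 1 = (\<integral>x. x * p x \<partial>std_normal_distribution)\<^sup>2"
    unfolding hermite_coeff_1[OF T] by (simp add: a_def)
  have S: "(\<lambda>k. \<rho> ^ k * a k) sums (\<integral>\<omega>. p (X \<omega>) * p (Y \<omega>) \<partial>M)"
    unfolding a_def by (rule trig_polynomial_correlation_sums[OF XY T])
  have S1: "a sums (\<integral>x. (p x)\<^sup>2 \<partial>std_normal_distribution)"
    using std_normal.trig_polynomial_correlation_sums[OF std_normal_correlated_self T]
    by (simp add: a_def[abs_def] power2_eq_square)
  have S2: "(\<lambda>k. \<rho> ^ (k + 2) * a (k + 2)) sums ((\<integral>\<omega>. p (X \<omega>) * p (Y \<omega>) \<partial>M) - a 0 - \<rho> * a 1)"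
    using sums_split_initial_segment[OF S, of 2] by (simp add: numeral_2_eq_2 algebra_simps)
  have S3: "(\<lambda>k. \<rho>\<^sup>2 * a (k + 2)) sums (\<rho>\<^sup>2 * ((\<integral>x. (p x)\<^sup>2 \<partial>std_normal_distribution) - a 0 - a 1))"
    using sums_mult[OF sums_split_initial_segment[OF S1, of 2], of "\<rho>\<^sup>2"] by (simp add: numeral_2_eq_2 algebra_simps)
  have "\<bar>\<rho> ^ (k + 2) * a (k + 2)\<bar> \<le> \<rho>\<^sup>2 * a (k + 2)" for k
  proof -
    have "\<bar>\<rho>\<bar> ^ k \<le> 1" using \<rho> by (simp add: power_le_one)
    then have "\<bar>\<rho>\<bar> ^ k * (\<rho>\<^sup>2 * a (k + 2)) \<le> 1 * (\<rho>\<^sup>2 * a (k + 2))"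
      by (intro mult_right_mono) (auto simp: a_nonneg)
    then show ?thesis
      using a_nonneg[of "k + 2"] by (simp add: abs_mult power_abs power_add power2_eq_square mult_ac)
  qed
  then have "\<bar>(\<integral>\<omega>. p (X \<omega>) * p (Y \<omega>) \<partial>M) - a 0 - \<rho> * a 1\<bar>
      \<le> \<rho>\<^sup>2 * ((\<integral>x. (p x)\<^sup>2 \<partial>std_normal_distribution) - a 0 - a 1)"
    using norm_suminf_le[OF _ sums_summable[OF S3], of "\<lambda>k. \<rho> ^ (k + 2) * a (k + 2)"]
    unfolding sums_unique[OF S2, symmetric] sums_unique[OF S3, symmetric] by simp
  also have "\<dots> \<le> \<rho>\<^sup>2 * (\<integral>x. (p x)\<^sup>2 \<partial>std_normal_distribution)"
    using a_nonneg[of 0] a_nonneg[of 1] by (intro mult_left_mono) auto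
  finally show ?thesis unfolding a0 a1 .
qed

section \<open>Density of trigonometric polynomials\<close>

text \<open>The closure of the trigonometric polynomials in \<open>L\<^sup>2\<close> of the standard normal law.\<close>

definition trig_approximable :: "(real \<Rightarrow> real) \<Rightarrow> bool" where
  "trig_approximable f \<longleftrightarrow> square_integrable std_normal_distribution f \<and>
     (\<forall>e>0. \<exists>p. trig_polynomial p \<and> (\<integral>x. (p x - f x)\<^sup>2 \<partial>std_normal_distribution) < e)"

lemma trig_polynomial_square_integrable_std_normal:
  "trig_polynomial p \<Longrightarrow> square_integrable std_normal_distribution p"
  using std_normal.trig_polynomial_square_integrable[of p "\<lambda>x. x"] by simp

lemma integral_power2_diff_triangle:
  assumes "square_integrable M f" "square_integrable M g" "square_integrable M h"
  shows "(\<integral>x. (f x - h x)\<^sup>2 \<partial>M) \<le> 2 * (\<integral>x. (f x - g x)\<^sup>2 \<partial>M) + 2 * (\<integral>x. (g x - h x)\<^sup>2 \<partial>M)"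
proof -
  have fg: "integrable M (\<lambda>x. (f x - g x)\<^sup>2)" and gh: "integrable M (\<lambda>x. (g x - h x)\<^sup>2)"
    and fh: "integrable M (\<lambda>x. (f x - h x)\<^sup>2)"
    by (intro square_integrable_power2 square_integrable_diff assms)+
  have le: "(a - c)\<^sup>2 \<le> 2 * (a - b)\<^sup>2 + 2 * (b - c)\<^sup>2" for a b c :: real
  proof -
    have "2 * (a - b)\<^sup>2 + 2 * (b - c)\<^sup>2 - (a - c)\<^sup>2 = (a - 2 * b + c)\<^sup>2"
      by (simp add: power2_eq_square algebra_simps)
    then show ?thesis using zero_le_power2[of "a - 2 * b + c"] by linarith
  qed
  have "(\<integral>x. (f x - h x)\<^sup>2 \<partial>M) \<le> (\<integral>x. 2 * (f x - g x)\<^sup>2 + 2 * (g x - h x)\<^sup>2 \<partial>M)"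
    by (intro integral_mono fh Bochner_Integration.integrable_add integrable_mult_right fg gh le)
  also have "\<dots> = 2 * (\<integral>x. (f x - g x)\<^sup>2 \<partial>M) + 2 * (\<integral>x. (g x - h x)\<^sup>2 \<partial>M)"
    using fg gh by simp
  finally show ?thesis .
qed

lemma trig_approximable_closed:
  assumes f: "square_integrable std_normal_distribution f"
    and approx: "\<And>e. 0 < e \<Longrightarrow> \<exists>g. trig_approximable g \<and> (\<integral>x. (g x - f x)\<^sup>2 \<partial>std_normal_distribution) < e"
  shows "trig_approximable f"
  unfolding trig_approximable_def
proof (intro conjI allI impI f)
  fix e :: real assume "0 < e"
  then obtain g where g: "trig_approximable g" "(\<integral>x. (g x - f x)\<^sup>2 \<partial>std_normal_distribution) < e / 4"
    using approx[of "e / 4"] by auto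
  then obtain p where p: "trig_polynomial p" "(\<integral>x. (p x - g x)\<^sup>2 \<partial>std_normal_distribution) < e / 4"
    using g(1)[unfolded trig_approximable_def, THEN conjunct2, rule_format, of "e / 4"] \<open>0 < e\<close> by auto
  have "(\<integral>x. (p x - f x)\<^sup>2 \<partial>std_normal_distribution)
      \<le> 2 * (\<integral>x. (p x - g x)\<^sup>2 \<partial>std_normal_distribution) + 2 * (\<integral>x. (g x - f x)\<^sup>2 \<partial>std_normal_distribution)"
    by (rule integral_power2_diff_triangle[OF trig_polynomial_square_integrable_std_normal[OF p(1)]
          g(1)[unfolded trig_approximable_def, THEN conjunct1] f])
  then show "\<exists>p. trig_polynomial p \<and> (\<integral>x. (p x - f x)\<^sup>2 \<partial>std_normal_distribution) < e"
    using p g by (intro exI[of _ p]) auto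
qed

lemma trig_approximable_trig_polynomial: "trig_polynomial p \<Longrightarrow> trig_approximable p"
  unfolding trig_approximable_def
  by (auto intro!: trig_polynomial_square_integrable_std_normal exI[of _ p])

lemma trig_approximable_add:
  assumes f: "trig_approximable f" and g: "trig_approximable g"
  shows "trig_approximable (\<lambda>x. f x + g x)"
  unfolding trig_approximable_def
proof (intro conjI allI impI)
  have sf: "square_integrable std_normal_distribution f" and sg: "square_integrable std_normal_distribution g"
    using f g by (auto simp: trig_approximable_def)
  show "square_integrable std_normal_distribution (\<lambda>x. f x + g x)"
    by (rule square_integrable_add[OF sf sg])
  fix e :: real assume "0 < e"
  then have "0 < e / 4" by simp
  then obtain p q where p: "trig_polynomial p" "(\<integral>x. (p x - f x)\<^sup>2 \<partial>std_normal_distribution) < e / 4"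
    and q: "trig_polynomial q" "(\<integral>x. (q x - g x)\<^sup>2 \<partial>std_normal_distribution) < e / 4"
    using f[unfolded trig_approximable_def, THEN conjunct2, rule_format, of "e / 4"]
      g[unfolded trig_approximable_def, THEN conjunct2, rule_format, of "e / 4"] by blast
  have sp: "square_integrable std_normal_distribution p" and sq: "square_integrable std_normal_distribution q"
    using p q by (auto intro: trig_polynomial_square_integrable_std_normal)
  have "(\<integral>x. ((p x + q x) - (f x + g x))\<^sup>2 \<partial>std_normal_distribution)
     \<le> 2 * (\<integral>x. ((p x + q x) - (f x + q x))\<^sup>2 \<partial>std_normal_distribution)
     + 2 * (\<integral>x. ((f x + q x) - (f x + g x))\<^sup>2 \<partial>std_normal_distribution)"
    by (intro integral_power2_diff_triangle square_integrable_add sp sq sf sg)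
  then have "(\<integral>x. ((p x + q x) - (f x + g x))\<^sup>2 \<partial>std_normal_distribution) < e"
    using p(2) q(2) by simp
  then show "\<exists>p. trig_polynomial p \<and> (\<integral>x. (p x - (f x + g x))\<^sup>2 \<partial>std_normal_distribution) < e"
    using trig_polynomial_add[OF p(1) q(1)] by blast
qed

lemma trig_approximable_cmult:
  assumes f: "trig_approximable f"
  shows "trig_approximable (\<lambda>x. a * f x)"
  unfolding trig_approximable_def
proof (intro conjI allI impI)
  have sf: "square_integrable std_normal_distribution f"
    using f by (auto simp: trig_approximable_def)
  show "square_integrable std_normal_distribution (\<lambda>x. a * f x)"
    by (rule square_integrable_cmult[OF sf])
  fix e :: real assume "0 < e"
  then have "0 < e / (a\<^sup>2 + 1)" by (simp add: add_nonneg_pos)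
  then obtain p where p: "trig_polynomial p" "(\<integral>x. (p x - f x)\<^sup>2 \<partial>std_normal_distribution) < e / (a\<^sup>2 + 1)"
    using f[unfolded trig_approximable_def, THEN conjunct2, rule_format] by blast
  have "(\<integral>x. (a * p x - a * f x)\<^sup>2 \<partial>std_normal_distribution) = a\<^sup>2 * (\<integral>x. (p x - f x)\<^sup>2 \<partial>std_normal_distribution)"
    by (simp flip: right_diff_distrib add: power_mult_distrib)
  also have "\<dots> \<le> (a\<^sup>2 + 1) * (\<integral>x. (p x - f x)\<^sup>2 \<partial>std_normal_distribution)"
    by (intro mult_right_mono) auto
  also have "\<dots> < e"
    using p(2) by (simp add: pos_less_divide_eq add_nonneg_pos mult.commute)
  finally show "\<exists>p. trig_polynomial p \<and> (\<integral>x. (p x - a * f x)\<^sup>2 \<partial>std_normal_distribution) < e"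
    using trig_polynomial_cmult[OF p(1)] by blast
qed

lemma trig_approximable_sum:
  "finite I \<Longrightarrow> (\<And>i. i \<in> I \<Longrightarrow> trig_approximable (f i)) \<Longrightarrow> trig_approximable (\<lambda>x. \<Sum>i\<in>I. f i x)"
  by (induction I rule: finite_induct)
     (auto intro: trig_approximable_add trig_approximable_trig_polynomial trig_polynomial_const)

text \<open>Pointwise dominated limits are \<open>L\<^sup>2\<close>-limits, by dominated convergence.\<close>

lemma trig_approximable_limit:
  assumes g: "\<And>n. trig_approximable (g n)" and lim: "\<And>x. (\<lambda>n. g n x) \<longlonglongrightarrow> f x"
    and bound: "\<And>n x. \<bar>g n x\<bar> \<le> h x" and h: "square_integrable std_normal_distribution h"
  shows "trig_approximable f"
proof (rule trig_approximable_closed)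
  have sg: "square_integrable std_normal_distribution (g n)" for n
    using g by (auto simp: trig_approximable_def)
  have [measurable]: "g n \<in> borel_measurable borel" "h \<in> borel_measurable borel" for n
    using sg[of n] h by (auto simp: square_integrable_def)
  have [measurable]: "f \<in> borel_measurable borel"
    by (rule borel_measurable_LIMSEQ_real[where u=g]) (auto intro: lim)
  have fh: "\<bar>f x\<bar> \<le> h x" for x
    by (rule LIMSEQ_le_const2[OF tendsto_rabs[OF lim]]) (auto intro: bound)
  show "square_integrable std_normal_distribution f"
    unfolding square_integrable_def
  proof
    show "integrable std_normal_distribution (\<lambda>x. (f x)\<^sup>2)"
    proof (rule Bochner_Integration.integrable_bound[OF square_integrable_power2[OF h]])
      show "AE x in std_normal_distribution. norm ((f x)\<^sup>2) \<le> norm ((h x)\<^sup>2)"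
        using power_mono[OF fh, of _ 2] by (intro AE_I2) simp
    qed measurable
  qed measurable
  have "(\<lambda>n. \<integral>x. (g n x - f x)\<^sup>2 \<partial>std_normal_distribution) \<longlonglongrightarrow> (\<integral>x. 0 \<partial>std_normal_distribution)"
  proof (rule integral_dominated_convergence[where w="\<lambda>x. 4 * (h x)\<^sup>2"])
    show "integrable std_normal_distribution (\<lambda>x. 4 * (h x)\<^sup>2)"
      using square_integrable_power2[OF h] by simp
    have "(\<lambda>n. (g n x - f x)\<^sup>2) \<longlonglongrightarrow> (f x - f x)\<^sup>2" for x
      by (intro tendsto_intros lim)
    then show "AE x in std_normal_distribution. (\<lambda>n. (g n x - f x)\<^sup>2) \<longlonglongrightarrow> 0"
      by simp
    have "(g n x - f x)\<^sup>2 \<le> 4 * (h x)\<^sup>2" for n x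
    proof -
      have "\<bar>g n x - f x\<bar> \<le> 2 * h x"
        using bound[of n x] fh[of x] by linarith
      from power_mono[OF this, of 2] show ?thesis by (simp add: power_mult_distrib)
    qed
    then show "AE x in std_normal_distribution. norm ((g n x - f x)\<^sup>2) \<le> 4 * (h x)\<^sup>2" for n
      by simp
  qed measurable
  then have "\<forall>\<^sub>F n in sequentially. (\<integral>x. (g n x - f x)\<^sup>2 \<partial>std_normal_distribution) < e" if "0 < e" for e
    using that by (intro order_tendstoD(2)) auto
  then show "\<exists>g. trig_approximable g \<and> (\<integral>x. (g x - f x)\<^sup>2 \<partial>std_normal_distribution) < e" if "0 < e" for e
    using eventually_happens[of _ sequentially] that g by fastforce
qed

lemma trig_approximable_id: "trig_approximable (\<lambda>x. x)"
proof (rule trig_approximable_limit[OF _ scaled_sin_tendsto scaled_sin_le])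
  show "trig_approximable (\<lambda>x. real (Suc n) * sin (1 / real (Suc n) * x))" for n
    by (intro trig_approximable_cmult trig_approximable_trig_polynomial trig_polynomial_sin)
  show "square_integrable std_normal_distribution (\<lambda>x. \<bar>x\<bar>)"
    using square_integrable_std_normal_id by (simp add: square_integrable_def)
qed

text \<open>Approximate \<open>F\<close> uniformly by a polynomial on \<open>{-1..1}\<close>, the range of the sine; uniform closeness implies
  \<open>L\<^sup>2\<close>-closeness for a probability measure.\<close>

lemma trig_approximable_compose_sin:
  fixes F :: "real \<Rightarrow> real"
  assumes F: "continuous_on UNIV F"
  shows "trig_approximable (\<lambda>x. F (sin (a * x)))"
proof (rule trig_approximable_closed)
  have [measurable]: "F \<in> borel_measurable borel"
    by (rule borel_measurable_continuous_onI[OF F])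
  have F': "continuous_on {-1..1} F" by (rule continuous_on_subset[OF F]) simp
  have "bounded (F ` {-1..1})"
    by (intro compact_imp_bounded compact_continuous_image F') simp
  then obtain B where B: "\<forall>y\<in>{-1..1}. \<bar>F y\<bar> \<le> B"
    unfolding bounded_iff by auto
  show s: "square_integrable std_normal_distribution (\<lambda>x. F (sin (a * x)))"
    by (rule std_normal.square_integrable_bounded[of _ B]) (use B in auto)
  fix e :: real assume "0 < e"
  define d where "d = sqrt (e / 2)"
  have "0 < d" "d\<^sup>2 = e / 2" using \<open>0 < e\<close> by (auto simp: d_def)
  then obtain q where q: "real_polynomial_function q" "\<And>y. y \<in> {-1..1} \<Longrightarrow> \<bar>F y - q y\<bar> < d"
    using Stone_Weierstrass_real_polynomial_function[of "{-1..1}" F d] F' by auto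
  have p: "trig_polynomial (\<lambda>x. q (sin (a * x)))"
    by (rule trig_polynomial_compose[OF q(1) trig_polynomial_sin])
  have "(\<integral>x. (q (sin (a * x)) - F (sin (a * x)))\<^sup>2 \<partial>std_normal_distribution) \<le> (\<integral>x. d\<^sup>2 \<partial>std_normal_distribution)"
  proof (rule integral_mono)
    show "integrable std_normal_distribution (\<lambda>x. (q (sin (a * x)) - F (sin (a * x)))\<^sup>2)"
      by (rule square_integrable_power2[OF square_integrable_diff[OF trig_polynomial_square_integrable_std_normal[OF p] s]])
    fix x
    have "\<bar>q (sin (a * x)) - F (sin (a * x))\<bar> \<le> d"
      using q(2)[of "sin (a * x)"] by simp
    from power_mono[OF this, of 2] show "(q (sin (a * x)) - F (sin (a * x)))\<^sup>2 \<le> d\<^sup>2" by simp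
  qed simp
  also have "\<dots> < e"
    using \<open>0 < e\<close> \<open>d\<^sup>2 = e / 2\<close> std_normal.prob_space by simp
  finally show "\<exists>g. trig_approximable g \<and> (\<integral>x. (g x - F (sin (a * x)))\<^sup>2 \<partial>std_normal_distribution) < e"
    using trig_approximable_trig_polynomial[OF p] by blast
qed

text \<open>A bounded continuous \<open>h\<close> is the bounded pointwise limit of the periodic functions
  \<open>h (n * sin (x / n))\<close>.\<close>

lemma trig_approximable_continuous:
  fixes h :: "real \<Rightarrow> real"
  assumes h: "continuous_on UNIV h" and B: "\<And>x. \<bar>h x\<bar> \<le> B"
  shows "trig_approximable h"
proof (rule trig_approximable_limit)
  show "trig_approximable (\<lambda>x. h (real (Suc n) * sin (1 / real (Suc n) * x)))" for n
    by (rule trig_approximable_compose_sin[of "\<lambda>y. h (real (Suc n) * y)"])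
       (intro continuous_on_compose2[OF h] continuous_intros, auto)
  show "(\<lambda>n. h (real (Suc n) * sin (1 / real (Suc n) * x))) \<longlonglongrightarrow> h x" for x
    by (rule continuous_on_tendsto_compose[OF h scaled_sin_tendsto]) auto
  show "\<bar>h (real (Suc n) * sin (1 / real (Suc n) * x))\<bar> \<le> B" for n x by (rule B)
qed (rule std_normal.square_integrable_const)

text \<open>The indicator of a closed set is the limit of continuous tents built from the distance to the set.\<close>

lemma trig_approximable_indicator_closed:
  fixes A :: "real set"
  assumes "closed A"
  shows "trig_approximable (indicator A)"
proof (cases "A = {}")
  case True
  then show ?thesis
    using trig_approximable_trig_polynomial[OF trig_polynomial_const[of 0]] by (simp add: fun_eq_iff indicator_def[abs_def])
next
  case False
  show ?thesis
  proof (rule trig_approximable_limit)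
    show "trig_approximable (\<lambda>x. max 0 (1 - real n * infdist x A))" for n
      by (rule trig_approximable_continuous[of _ 1]) (auto intro!: continuous_intros simp: infdist_nonneg)
    show "\<bar>max 0 (1 - real n * infdist x A)\<bar> \<le> 1" for n x
      by (auto simp: infdist_nonneg)
    show "(\<lambda>n. max 0 (1 - real n * infdist x A)) \<longlonglongrightarrow> indicator A x" for x
    proof (cases "x \<in> A")
      case True
      then show ?thesis by simp
    next
      case x: False
      then have pos: "0 < infdist x A"
        using in_closed_iff_infdist_zero[OF assms False, of x] infdist_nonneg[of x A] by linarith
      obtain N where N: "1 < real N * infdist x A"
        using reals_Archimedean3[OF pos] by blast
      have "max 0 (1 - real n * infdist x A) = 0" if "N \<le> n" for n
      proof -
        have "real N * infdist x A \<le> real n * infdist x A"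
          using that pos by (intro mult_right_mono) auto
        then show ?thesis using N by simp
      qed
      then have "\<forall>\<^sub>F n in sequentially. max 0 (1 - real n * infdist x A) = 0"
        by (auto simp: eventually_sequentially)
      then show ?thesis using x by (simp add: tendsto_eventually)
    qed
  qed (rule std_normal.square_integrable_const)
qed

text \<open>Closed sets form an intersection-stable generator of the Borel sets, and the sets with approximable
  indicator are closed under complements and countable disjoint unions.\<close>

lemma trig_approximable_indicator:
  fixes A :: "real set"
  assumes "A \<in> sets borel"
  shows "trig_approximable (indicator A)"
proof -
  have "Int_stable (Collect closed :: real set set)" "Collect closed \<subseteq> Pow (UNIV :: real set)"
    "A \<in> sigma_sets UNIV (Collect closed)"
    using assms by (auto simp: Int_stable_def borel_eq_closed)
  then show ?thesis
  proof (induction rule: sigma_sets_induct_disjoint)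
    case (basic A)
    then show ?case by (simp add: trig_approximable_indicator_closed)
  next
    case empty
    show ?case by (rule trig_approximable_indicator_closed) simp
  next
    case (compl A)
    have "indicator (UNIV - A) = (\<lambda>x. 1 + (-1) * indicator A x :: real)"
      by (auto simp: indicator_def)
    then show ?case
      using trig_approximable_add[OF trig_approximable_trig_polynomial[OF trig_polynomial_const[of 1]]
          trig_approximable_cmult[OF compl.IH, of "-1"]] by metis
  next
    case (union A)
    show ?case
    proof (rule trig_approximable_limit)
      have eq: "(\<Sum>i<n. indicator (A i) x) = (indicator (\<Union>i<n. A i) x :: real)" for n x
        by (rule indicator_UN_disjoint[symmetric]) (use union in \<open>auto simp: disjoint_family_on_def\<close>)
      show "trig_approximable (\<lambda>x. indicator (\<Union>i<n. A i) x)" for n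
        unfolding eq[symmetric] by (intro trig_approximable_sum union) auto
      show "(\<lambda>n. indicator (\<Union>i<n. A i) x) \<longlonglongrightarrow> (indicator (\<Union>i. A i) x :: real)" for x
        by (rule LIMSEQ_indicator_UN)
      show "\<bar>indicator (\<Union>i<n. A i) x :: real\<bar> \<le> 1" for n x by (simp add: indicator_def)
    qed (rule std_normal.square_integrable_const)
  qed
qed

section \<open>Correlation of nonlinear functions of Gaussian variables\<close>

lemma (in prob_space) correlated_std_normal_distr:
  assumes "correlated_std_normal \<rho> X Y"
  shows "distr M borel X = std_normal_distribution" "distr M borel Y = std_normal_distribution"
proof -
  have [measurable]: "X \<in> borel_measurable M" "Y \<in> borel_measurable M"
    and ch: "\<And>a b. (\<integral>\<omega>. iexp (a * X \<omega> + b * Y \<omega>) \<partial>M) = exp (- (a\<^sup>2 + 2 * \<rho> * a * b + b\<^sup>2) / 2)"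
    using assms by (auto simp: correlated_std_normal_def)
  have rd: "real_distribution (distr M borel Z)" if "Z \<in> borel_measurable M" for Z
    using that by (rule real_distribution_distr)
  show "distr M borel X = std_normal_distribution"
  proof (rule Levy_uniqueness[OF rd real_dist_normal_dist])
    show "char (distr M borel X) = char std_normal_distribution"
      unfolding char_std_normal_distribution using ch[of _ 0]
      by (simp add: char_def integral_distr fun_eq_iff)
  qed measurable
  show "distr M borel Y = std_normal_distribution"
  proof (rule Levy_uniqueness[OF rd real_dist_normal_dist])
    show "char (distr M borel Y) = char std_normal_distribution"
      unfolding char_std_normal_distribution using ch[of 0]
      by (simp add: char_def integral_distr fun_eq_iff)
  qed measurable
qed

lemma (in prob_space) square_integrable_distr:
  assumes X: "X \<in> borel_measurable M" "distr M borel X = N" and f: "square_integrable N f"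
  shows "square_integrable M (\<lambda>\<omega>. f (X \<omega>))"
    and "(\<integral>\<omega>. (f (X \<omega>))\<^sup>2 \<partial>M) = (\<integral>x. (f x)\<^sup>2 \<partial>N)"
proof -
  have [measurable]: "f \<in> borel_measurable borel"
    using f unfolding X(2)[symmetric] by (simp add: square_integrable_def)
  have "integrable M (\<lambda>\<omega>. (f (X \<omega>))\<^sup>2)"
    using square_integrable_power2[OF f] unfolding X(2)[symmetric]
    by (subst (asm) integrable_distr_eq) (use X in auto)
  then show "square_integrable M (\<lambda>\<omega>. f (X \<omega>))"
    using X(1) by (simp add: square_integrable_def)
  show "(\<integral>\<omega>. (f (X \<omega>))\<^sup>2 \<partial>M) = (\<integral>x. (f x)\<^sup>2 \<partial>N)"
    unfolding X(2)[symmetric] using X(1) by (subst integral_distr) auto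
qed

text \<open>Both sides of the bound for trigonometric polynomials are continuous in \<open>L\<^sup>2\<close>. Only the marginal laws
  enter the passage to the limit, by the Cauchy-Schwarz inequality, and these are standard normal.\<close>

theorem (in prob_space) gaussian_correlation_bound:
  assumes XY: "correlated_std_normal \<rho> X Y" and \<rho>: "\<bar>\<rho>\<bar> \<le> 1" and f: "trig_approximable f"
  shows "\<bar>(\<integral>\<omega>. f (X \<omega>) * f (Y \<omega>) \<partial>M) - (\<integral>x. f x \<partial>std_normal_distribution)\<^sup>2
            - \<rho> * (\<integral>x. x * f x \<partial>std_normal_distribution)\<^sup>2\<bar>
          \<le> \<rho>\<^sup>2 * (\<integral>x. (f x)\<^sup>2 \<partial>std_normal_distribution)"
proof -
  have X: "X \<in> borel_measurable M" and Y: "Y \<in> borel_measurable M"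
    using XY by (auto simp: correlated_std_normal_def)
  note dist = correlated_std_normal_distr[OF XY]
  have sf: "square_integrable std_normal_distribution f"
    using f by (simp add: trig_approximable_def)
  have "\<exists>p. trig_polynomial p \<and> (\<integral>x. (p x - f x)\<^sup>2 \<partial>std_normal_distribution) < 1 / real (Suc n)" for n
    using f unfolding trig_approximable_def by simp
  then obtain p where p: "\<And>n. trig_polynomial (p n)"
    and pf: "\<And>n. (\<integral>x. (p n x - f x)\<^sup>2 \<partial>std_normal_distribution) < 1 / real (Suc n)" by metis
  have sp: "square_integrable std_normal_distribution (p n)" for n
    by (rule trig_polynomial_square_integrable_std_normal[OF p])
  have lim: "(\<lambda>n. \<integral>x. (p n x - f x)\<^sup>2 \<partial>std_normal_distribution) \<longlonglongrightarrow> 0"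
  proof (rule tendsto_sandwich[OF _ _ tendsto_const LIMSEQ_inverse_real_of_nat])
    show "\<forall>\<^sub>F n in sequentially. (\<integral>x. (p n x - f x)\<^sup>2 \<partial>std_normal_distribution) \<le> inverse (real (Suc n))"
      using pf by (auto intro!: always_eventually less_imp_le simp: inverse_eq_divide)
  qed simp
  have limM: "(\<lambda>n. \<integral>\<omega>. (p n (Z \<omega>) - f (Z \<omega>))\<^sup>2 \<partial>M) \<longlonglongrightarrow> 0"
    if "Z \<in> borel_measurable M" "distr M borel Z = std_normal_distribution" for Z
    using lim square_integrable_distr(2)[OF that square_integrable_diff[OF sp sf]] by simp
  have 1: "(\<lambda>n. \<integral>\<omega>. p n (X \<omega>) * p n (Y \<omega>) \<partial>M) \<longlonglongrightarrow> (\<integral>\<omega>. f (X \<omega>) * f (Y \<omega>) \<partial>M)"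
    by (intro tendsto_integral_mult_L2 limM X Y dist
        square_integrable_distr(1)[OF X dist(1)] square_integrable_distr(1)[OF Y dist(2)] sp sf)
  have 2: "(\<lambda>n. \<integral>x. g x * p n x \<partial>std_normal_distribution) \<longlonglongrightarrow> (\<integral>x. g x * f x \<partial>std_normal_distribution)"
    if "square_integrable std_normal_distribution g" for g
    using tendsto_integral_mult_L2[of std_normal_distribution "\<lambda>_. g" g p f] that sp sf lim by simp
  have 3: "(\<lambda>n. \<integral>x. (p n x)\<^sup>2 \<partial>std_normal_distribution) \<longlonglongrightarrow> (\<integral>x. (f x)\<^sup>2 \<partial>std_normal_distribution)"
    by (rule tendsto_integral_power2_L2[OF sp sf lim])
  have 4: "(\<lambda>n. \<integral>x. p n x \<partial>std_normal_distribution) \<longlonglongrightarrow> (\<integral>x. f x \<partial>std_normal_distribution)"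
    using 2[OF std_normal.square_integrable_const[of 1]] by simp
  show ?thesis
    by (rule LIMSEQ_le[OF tendsto_rabs[OF tendsto_diff[OF tendsto_diff[OF 1 tendsto_power[OF 4]]
            tendsto_mult[OF tendsto_const tendsto_power[OF 2[OF square_integrable_std_normal_id]]]]]
          tendsto_mult[OF tendsto_const 3]])
       (auto intro!: trig_polynomial_correlation_bound[OF XY \<rho> p])
qed

section \<open>Stationary Gaussian fields\<close>

text \<open>A centred Gaussian variable is determined by its second moment. The degenerate case fits the same
  formula, with second moment \<open>0\<close>.\<close>

lemma (in prob_space) gaussian_rv_centered:
  assumes Z: "gaussian_rv M Z" and mean: "(\<integral>\<omega>. Z \<omega> \<partial>M) = 0"
  shows "square_integrable M Z"
    and "(\<integral>\<omega>. iexp (t * Z \<omega>) \<partial>M) = complex_of_real (exp (- t\<^sup>2 * (\<integral>\<omega>. (Z \<omega>)\<^sup>2 \<partial>M) / 2))"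
proof -
  have [measurable]: "Z \<in> borel_measurable M" using Z by (simp add: gaussian_rv_def)
  obtain \<mu> \<sigma> where cases: "(\<sigma> > 0 \<and> distributed M lborel Z (normal_density \<mu> \<sigma>)) \<or>
            (\<sigma> = 0 \<and> (AE \<omega> in M. Z \<omega> = \<mu>))"
    using Z by (auto simp: gaussian_rv_def)
  have "square_integrable M Z \<and>
    (\<integral>\<omega>. iexp (t * Z \<omega>) \<partial>M) = complex_of_real (exp (- t\<^sup>2 * (\<integral>\<omega>. (Z \<omega>)\<^sup>2 \<partial>M) / 2))"
    using cases
  proof
    assume A: "\<sigma> > 0 \<and> distributed M lborel Z (normal_density \<mu> \<sigma>)"
    then have "\<mu> = 0"
      using normal_distributed_expectation[of \<sigma> Z \<mu>] mean by simp
    define U where "U = (\<lambda>\<omega>. Z \<omega> / \<sigma>)"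
    have ZU: "Z \<omega> = \<sigma> * U \<omega>" for \<omega> using A by (simp add: U_def)
    have U [measurable]: "U \<in> borel_measurable M" by (simp add: U_def)
    have "distributed M lborel U std_normal_density"
      using A normal_standard_normal_convert[of \<sigma> Z \<mu>] \<open>\<mu> = 0\<close> by (simp add: U_def)
    then have "distr M lborel U = std_normal_distribution"
      by (rule distributed_distr_eq_density)
    moreover have "distr M borel U = distr M lborel U" by (rule distr_cong) auto
    ultimately have dU: "distr M borel U = std_normal_distribution" by simp
    note sU = square_integrable_distr[OF U dU square_integrable_std_normal_id]
    have "(\<integral>x. x\<^sup>2 \<partial>std_normal_distribution) = (1::real)"
      using std_normal_distribution_even_moments(1)[of 1] by simp
    then have EZ: "(\<integral>\<omega>. (Z \<omega>)\<^sup>2 \<partial>M) = \<sigma>\<^sup>2"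
      using sU(2) by (simp add: ZU power_mult_distrib)
    have "(\<integral>\<omega>. iexp (t * Z \<omega>) \<partial>M) = (\<integral>\<omega>. iexp ((t * \<sigma>) * U \<omega>) \<partial>M)"
      by (simp add: ZU mult.assoc)
    also have "\<dots> = (\<integral>x. iexp ((t * \<sigma>) * x) \<partial>distr M borel U)"
      by (subst integral_distr) auto
    also have "\<dots> = complex_of_real (exp (- (t * \<sigma>)\<^sup>2 / 2))"
      unfolding dU by (rule std_normal_iexp)
    finally have "(\<integral>\<omega>. iexp (t * Z \<omega>) \<partial>M) = complex_of_real (exp (- t\<^sup>2 * \<sigma>\<^sup>2 / 2))"
      by (simp only: power_mult_distrib mult_minus_left)
    moreover have "square_integrable M Z"
      using square_integrable_cmult[OF sU(1), of \<sigma>] by (simp flip: ZU)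
    ultimately show ?thesis by (simp only: EZ)
  next
    assume A: "\<sigma> = 0 \<and> (AE \<omega> in M. Z \<omega> = \<mu>)"
    then have "(\<integral>\<omega>. Z \<omega> \<partial>M) = (\<integral>\<omega>. \<mu> \<partial>M)" by (intro integral_cong_AE) auto
    then have "\<mu> = 0" using mean by (simp add: prob_space)
    with A have Z0: "AE \<omega> in M. Z \<omega> = 0" by simp
    have "(\<integral>\<omega>. iexp (t * Z \<omega>) \<partial>M) = (\<integral>\<omega>. 1 \<partial>M)"
      using Z0 by (intro integral_cong_AE) (auto elim: eventually_mono)
    moreover have "(\<integral>\<omega>. (Z \<omega>)\<^sup>2 \<partial>M) = (\<integral>\<omega>. 0 \<partial>M)"
      using Z0 by (intro integral_cong_AE) (auto elim: eventually_mono)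
    moreover have "integrable M (\<lambda>\<omega>. (Z \<omega>)\<^sup>2) \<longleftrightarrow> integrable M (\<lambda>\<omega>. 0 :: real)"
      using Z0 by (intro integrable_cong_AE) (auto elim: eventually_mono)
    ultimately show ?thesis by (simp add: square_integrable_def prob_space)
  qed
  then show "square_integrable M Z"
    and "(\<integral>\<omega>. iexp (t * Z \<omega>) \<partial>M) = complex_of_real (exp (- t\<^sup>2 * (\<integral>\<omega>. (Z \<omega>)\<^sup>2 \<partial>M) / 2))"
    by auto
qed

locale std_gaussian_field = prob_space M for M :: "'w measure" +
  fixes Y :: "real ^ 'd \<Rightarrow> 'w \<Rightarrow> real"
  assumes field_measurable: "measurable_random_field M Y"
    and field_centered: "centered_random_field M Y"
    and field_stationary: "stationary_random_field M Y"
    and field_gaussian: "gaussian_random_field M Y"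
    and field_variance: "(\<integral>\<omega>. (Y 0 \<omega>)\<^sup>2 \<partial>M) = 1"
begin

abbreviation cov :: "real ^ 'd \<Rightarrow> real" where
  "cov \<equiv> covariance_function M Y"

text \<open>Repeated locations are allowed here: their coefficients are added.\<close>

lemma gaussian_rv_linear_combination:
  assumes "finite I"
  shows "gaussian_rv M (\<lambda>\<omega>. \<Sum>i\<in>I. a i * Y (t i) \<omega>)"
proof -
  have "(\<Sum>i\<in>I. a i * Y (t i) \<omega>) = (\<Sum>s\<in>t ` I. (\<Sum>i\<in>{i. i \<in> I \<and> t i = s}. a i) * Y s \<omega>)" for \<omega>
    by (subst sum.image_gen[OF assms, of _ t]) (auto simp: sum_distrib_right intro!: sum.cong)
  then show ?thesis
    using field_gaussian assms by (simp add: gaussian_random_field_def)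
qed

lemma gaussian_rv_Y: "gaussian_rv M (Y t)"
  using gaussian_rv_linear_combination[of "{()}" "\<lambda>_. 1" "\<lambda>_. t"] by simp

lemma Y_centered: "integrable M (Y t)" "(\<integral>\<omega>. Y t \<omega> \<partial>M) = 0"
  using field_centered by (auto simp: centered_random_field_def)

lemma Y_square_integrable: "square_integrable M (Y t)"
  by (rule gaussian_rv_centered(1)[OF gaussian_rv_Y Y_centered(2)])

lemma Y_borel [measurable]: "Y t \<in> borel_measurable M"
  using Y_square_integrable[of t] by (simp add: square_integrable_def)

lemma linear_combination_iexp:
  assumes "finite I"
  shows "(\<integral>\<omega>. iexp (\<theta> * (\<Sum>i\<in>I. a i * Y (t i) \<omega>)) \<partial>M)
     = complex_of_real (exp (- \<theta>\<^sup>2 * (\<integral>\<omega>. (\<Sum>i\<in>I. a i * Y (t i) \<omega>)\<^sup>2 \<partial>M) / 2))"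
proof (rule gaussian_rv_centered(2)[OF gaussian_rv_linear_combination[OF assms]])
  show "(\<integral>\<omega>. (\<Sum>i\<in>I. a i * Y (t i) \<omega>) \<partial>M) = 0"
    by (simp add: Y_centered)
qed

text \<open>Stationarity is applied to the two locations \<open>s - t\<close> and \<open>0\<close>, shifted by \<open>t\<close>; integrating the product
  of the two coordinates against the common law yields both sides.\<close>

lemma covariance: "(\<integral>\<omega>. Y s \<omega> * Y t \<omega> \<partial>M) = cov (s - t)"
proof -
  define T where "T = {s - t, 0}"
  have [measurable]: "(\<lambda>x. x (s - t) * x 0 :: real) \<in> borel_measurable (\<Pi>\<^sub>M t\<in>T. borel)"
    by (intro borel_measurable_times measurable_component_singleton) (auto simp: T_def)
  have [measurable]: "(\<lambda>\<omega>. \<lambda>r\<in>T. Y (r + h) \<omega>) \<in> M \<rightarrow>\<^sub>M (\<Pi>\<^sub>M t\<in>T. borel)" for h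
    by measurable
  have I: "(\<integral>x. x (s - t) * x 0 \<partial>distr M (\<Pi>\<^sub>M t\<in>T. borel) (\<lambda>\<omega>. \<lambda>r\<in>T. Y (r + h) \<omega>))
      = (\<integral>\<omega>. Y (s - t + h) \<omega> * Y h \<omega> \<partial>M)" for h
    by (subst integral_distr) (auto simp: T_def)
  have "distr M (\<Pi>\<^sub>M r\<in>T. borel) (\<lambda>\<omega>. \<lambda>r\<in>T. Y (r + t) \<omega>) =
        distr M (\<Pi>\<^sub>M r\<in>T. borel) (\<lambda>\<omega>. \<lambda>r\<in>T. Y (r + 0) \<omega>)"
    using field_stationary by (simp add: stationary_random_field_def T_def)
  with I[of t] I[of 0] show ?thesis
    by (simp add: covariance_function_def)
qed

lemma variance_Y: "(\<integral>\<omega>. (Y t \<omega>)\<^sup>2 \<partial>M) = 1"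
  using covariance[of t t] covariance[of 0 0] field_variance by (simp add: power2_eq_square)

lemma covariance_le_1: "\<bar>cov t\<bar> \<le> 1"
  using abs_integral_mult_le[OF Y_square_integrable Y_square_integrable, of t 0]
  by (simp add: covariance variance_Y)

lemma pair_measurable:
  assumes "sets N = sets borel"
  shows "(\<lambda>(t, \<omega>). Y t \<omega>) \<in> borel_measurable (N \<Otimes>\<^sub>M M)"
  using field_measurable unfolding measurable_random_field_def
  by (simp add: measurable_cong_sets[OF sets_pair_measure_cong[OF assms refl] refl])

lemma covariance_measurable [measurable]: "cov \<in> borel_measurable borel"
proof -
  have [measurable]: "(\<lambda>(t, \<omega>). Y t \<omega>) \<in> borel_measurable (borel \<Otimes>\<^sub>M M)"
    by (rule pair_measurable) simp
  show ?thesis unfolding covariance_function_def[abs_def] by measurable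
qed

lemma correlated_std_normal_Y: "correlated_std_normal (cov (s - t)) (Y s) (Y t)"
proof -
  have "(\<integral>\<omega>. iexp (a * Y s \<omega> + b * Y t \<omega>) \<partial>M) = exp (- (a\<^sup>2 + 2 * cov (s - t) * a * b + b\<^sup>2) / 2)" for a b
  proof -
    have "(\<integral>\<omega>. (a * Y s \<omega> + b * Y t \<omega>)\<^sup>2 \<partial>M)
       = (\<integral>\<omega>. a\<^sup>2 * (Y s \<omega>)\<^sup>2 + 2 * a * b * (Y s \<omega> * Y t \<omega>) + b\<^sup>2 * (Y t \<omega>)\<^sup>2 \<partial>M)"
      by (intro arg_cong[where f="integral\<^sup>L M"] ext) (simp add: power2_eq_square algebra_simps)
    also have "\<dots> = a\<^sup>2 + 2 * a * b * cov (s - t) + b\<^sup>2"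
      using square_integrable_mult[OF Y_square_integrable Y_square_integrable, of s t]
        square_integrable_power2[OF Y_square_integrable]
      by (simp add: covariance variance_Y)
    finally have "(\<integral>\<omega>. (a * Y s \<omega> + b * Y t \<omega>)\<^sup>2 \<partial>M) = a\<^sup>2 + 2 * cov (s - t) * a * b + b\<^sup>2"
      by simp
    then show ?thesis
      using linear_combination_iexp[of "{True, False}" 1 "\<lambda>i. if i then a else b" "\<lambda>i. if i then s else t"]
      by simp
  qed
  then show ?thesis by (simp add: correlated_std_normal_def)
qed

lemma Y_distr: "distr M borel (Y t) = std_normal_distribution"
  by (rule correlated_std_normal_distr(1)[OF correlated_std_normal_Y])

text \<open>The empirical means \<open>G m\<close> over well chosen points are centred Gaussian and converge to the average in
  \<open>L\<^sup>2\<close>. Hence their characteristic functions and their variances converge to those of the average.\<close>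

lemma average_gaussian:
  assumes N: "prob_space N" and sN: "sets N = sets borel"
  shows "square_integrable M (\<lambda>\<omega>. \<integral>t. Y t \<omega> \<partial>N)"
    and "(\<integral>\<omega>. (\<integral>t. Y t \<omega> \<partial>N)\<^sup>2 \<partial>M) = (\<integral>t. (\<integral>s. cov (s - t) \<partial>N) \<partial>N)"
    and "(\<integral>\<omega>. iexp (\<theta> * (\<integral>t. Y t \<omega> \<partial>N)) \<partial>M)
     = complex_of_real (exp (- \<theta>\<^sup>2 * (\<integral>t. (\<integral>s. cov (s - t) \<partial>N) \<partial>N) / 2))"
proof -
  interpret N: prob_space N by (rule N)
  interpret NM: pair_prob_space N M ..
  note proc = pair_measurable[OF sN] Y_square_integrable variance_Y[THEN eq_refl]
  define A where "A \<omega> = (\<integral>t. Y t \<omega> \<partial>N)" for \<omega>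
  have A: "square_integrable M A"
    unfolding A_def by (rule NM.square_integrable_average[OF proc])
  then show "square_integrable M (\<lambda>\<omega>. \<integral>t. Y t \<omega> \<partial>N)" by (simp add: A_def[abs_def])
  show EA: "(\<integral>\<omega>. (\<integral>t. Y t \<omega> \<partial>N)\<^sup>2 \<partial>M) = (\<integral>t. (\<integral>s. cov (s - t) \<partial>N) \<partial>N)"
    using NM.expectation_average_power2[OF proc] by (simp add: covariance)
  have "\<exists>ts. (\<integral>\<omega>. ((\<Sum>i<Suc m. Y (ts i) \<omega>) - real (Suc m) * A \<omega>)\<^sup>2 \<partial>M) \<le> real (Suc m) * 1" for m
    using NM.sampling_approximates_average[OF proc, of "Suc m"] unfolding A_def by blast
  then obtain ts where ts: "\<And>m. (\<integral>\<omega>. ((\<Sum>i<Suc m. Y (ts m i) \<omega>) - real (Suc m) * A \<omega>)\<^sup>2 \<partial>M) \<le> real (Suc m)"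
    unfolding mult_1_right by metis
  define G where "G m \<omega> = (\<Sum>i<Suc m. 1 / real (Suc m) * Y (ts m i) \<omega>)" for m \<omega>
  have G: "square_integrable M (G m)" for m
    unfolding G_def by (intro square_integrable_sum square_integrable_cmult Y_square_integrable)
  have GA: "(\<integral>\<omega>. (G m \<omega> - A \<omega>)\<^sup>2 \<partial>M) \<le> 1 / real (Suc m)" for m
  proof -
    have "G m \<omega> - A \<omega> = (1 / real (Suc m)) * ((\<Sum>i<Suc m. Y (ts m i) \<omega>) - real (Suc m) * A \<omega>)" for \<omega>
      unfolding G_def sum_distrib_left[symmetric] by (simp add: right_diff_distrib del: sum.lessThan_Suc of_nat_Suc)
    then have "(\<integral>\<omega>. (G m \<omega> - A \<omega>)\<^sup>2 \<partial>M)
      = (1 / real (Suc m))\<^sup>2 * (\<integral>\<omega>. ((\<Sum>i<Suc m. Y (ts m i) \<omega>) - real (Suc m) * A \<omega>)\<^sup>2 \<partial>M)"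
      by (simp only: power_mult_distrib integral_mult_right_zero)
    also have "\<dots> \<le> (1 / real (Suc m))\<^sup>2 * real (Suc m)"
      by (intro mult_left_mono ts) simp
    also have "\<dots> = 1 / real (Suc m)" by (simp add: power2_eq_square)
    finally show ?thesis .
  qed
  have lim: "(\<lambda>m. \<integral>\<omega>. (G m \<omega> - A \<omega>)\<^sup>2 \<partial>M) \<longlonglongrightarrow> 0"
  proof (rule tendsto_sandwich[OF _ _ tendsto_const LIMSEQ_inverse_real_of_nat])
    show "\<forall>\<^sub>F m in sequentially. (\<integral>\<omega>. (G m \<omega> - A \<omega>)\<^sup>2 \<partial>M) \<le> inverse (real (Suc m))"
      using GA by (simp add: inverse_eq_divide)
  qed simp
  have "(\<lambda>m. \<integral>\<omega>. iexp (\<theta> * G m \<omega>) \<partial>M) \<longlonglongrightarrow> (\<integral>\<omega>. iexp (\<theta> * A \<omega>) \<partial>M)"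
  proof (rule LIM_zero_cancel, rule Lim_null_comparison)
    show "\<forall>\<^sub>F m in sequentially. norm ((\<integral>\<omega>. iexp (\<theta> * G m \<omega>) \<partial>M) - (\<integral>\<omega>. iexp (\<theta> * A \<omega>) \<partial>M))
        \<le> \<bar>\<theta>\<bar> * sqrt (\<integral>\<omega>. (G m \<omega> - A \<omega>)\<^sup>2 \<partial>M)"
      by (intro always_eventually allI norm_expectation_iexp_diff_le G A)
    show "(\<lambda>m. \<bar>\<theta>\<bar> * sqrt (\<integral>\<omega>. (G m \<omega> - A \<omega>)\<^sup>2 \<partial>M)) \<longlonglongrightarrow> 0"
      using tendsto_mult[OF tendsto_const[of "\<bar>\<theta>\<bar>"] tendsto_real_sqrt[OF lim]] by simp
  qed
  moreover have "(\<integral>\<omega>. iexp (\<theta> * G m \<omega>) \<partial>M) = complex_of_real (exp (- \<theta>\<^sup>2 * (\<integral>\<omega>. (G m \<omega>)\<^sup>2 \<partial>M) / 2))" for m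
    unfolding G_def by (rule linear_combination_iexp) simp
  moreover have "(\<lambda>m. complex_of_real (exp (- \<theta>\<^sup>2 * (\<integral>\<omega>. (G m \<omega>)\<^sup>2 \<partial>M) / 2)))
      \<longlonglongrightarrow> complex_of_real (exp (- \<theta>\<^sup>2 * (\<integral>\<omega>. (A \<omega>)\<^sup>2 \<partial>M) / 2))"
    by (intro tendsto_intros tendsto_integral_power2_L2[OF G A lim]) auto
  ultimately have "(\<integral>\<omega>. iexp (\<theta> * A \<omega>) \<partial>M) = complex_of_real (exp (- \<theta>\<^sup>2 * (\<integral>\<omega>. (A \<omega>)\<^sup>2 \<partial>M) / 2))"
    by (auto intro: LIMSEQ_unique)
  then show "(\<integral>\<omega>. iexp (\<theta> * (\<integral>t. Y t \<omega> \<partial>N)) \<partial>M)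
     = complex_of_real (exp (- \<theta>\<^sup>2 * (\<integral>t. (\<integral>s. cov (s - t) \<partial>N) \<partial>N) / 2))"
    unfolding A_def EA .
qed

text \<open>Expand the second moment of the average into a double integral of correlations. As \<open>R\<close> has no constant
  and no linear Hermite component, each correlation is bounded by the squared covariance.\<close>

lemma average_hermite_rank_2_bound:
  assumes N: "prob_space N" and sN: "sets N = sets borel"
    and R: "trig_approximable R" and R0: "(\<integral>x. R x \<partial>std_normal_distribution) = 0"
    and R1: "(\<integral>x. x * R x \<partial>std_normal_distribution) = 0"
  shows "(\<integral>\<omega>. (\<integral>t. R (Y t \<omega>) \<partial>N)\<^sup>2 \<partial>M)
     \<le> (\<integral>x. (R x)\<^sup>2 \<partial>std_normal_distribution) * (\<integral>t. (\<integral>s. (cov (s - t))\<^sup>2 \<partial>N) \<partial>N)"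
proof -
  interpret N: prob_space N by (rule N)
  interpret NM: pair_prob_space N M ..
  define K where "K = (\<integral>x. (R x)\<^sup>2 \<partial>std_normal_distribution)"
  have sR: "square_integrable std_normal_distribution R"
    using R by (simp add: trig_approximable_def)
  then have [measurable]: "R \<in> borel_measurable borel" by (simp add: square_integrable_def)
  note [measurable] = pair_measurable[OF sN]
  have cov_N [measurable]: "(\<lambda>(t, s). cov (s - t)) \<in> borel_measurable (N \<Otimes>\<^sub>M N)"
  proof -
    have "(\<lambda>(t, s). cov (s - t)) \<in> borel_measurable (borel \<Otimes>\<^sub>M borel)" by measurable
    then show ?thesis
      by (simp add: measurable_cong_sets[OF sets_pair_measure_cong[OF sN sN] refl])
  qed
  have proc: "(\<lambda>(t, \<omega>). R (Y t \<omega>)) \<in> borel_measurable (N \<Otimes>\<^sub>M M)"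
    "\<And>t. square_integrable M (\<lambda>\<omega>. R (Y t \<omega>))" "\<And>t. (\<integral>\<omega>. (R (Y t \<omega>))\<^sup>2 \<partial>M) \<le> K"
    using square_integrable_distr[OF Y_borel Y_distr sR] by (auto simp: K_def)
  have corr: "\<bar>\<integral>\<omega>. R (Y s \<omega>) * R (Y t \<omega>) \<partial>M\<bar> \<le> K * (cov (s - t))\<^sup>2" for s t
    using gaussian_correlation_bound[OF correlated_std_normal_Y covariance_le_1 R, of s t] R0 R1
    by (simp add: K_def mult.commute)
  have K0: "0 \<le> K" by (simp add: K_def)
  have cov2: "0 \<le> (cov z)\<^sup>2" "(cov z)\<^sup>2 \<le> 1" for z
    using covariance_le_1[of z] by (auto simp: abs_square_le_1)
  have meas_s: "(\<lambda>s. cov (s - t)) \<in> borel_measurable N" for t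
    unfolding measurable_cong_sets[OF sN refl] by measurable
  have iC: "integrable N (\<lambda>s. K * (cov (s - t))\<^sup>2)" for t
    using meas_s[of t] cov2 by (intro integrable_mult_right N.integrable_const_bound[of _ 1]) auto
  have "(\<integral>\<omega>. (\<integral>t. R (Y t \<omega>) \<partial>N)\<^sup>2 \<partial>M) = (\<integral>t. (\<integral>s. (\<integral>\<omega>. R (Y s \<omega>) * R (Y t \<omega>) \<partial>M) \<partial>N) \<partial>N)"
    by (rule NM.expectation_average_power2[OF proc])
  also have "\<dots> \<le> (\<integral>t. (\<integral>s. K * (cov (s - t))\<^sup>2 \<partial>N) \<partial>N)"
  proof (rule integral_mono)
    have "integrable N (\<lambda>t. \<integral>\<omega>. R (Y t \<omega>) * (\<integral>s. R (Y s \<omega>) \<partial>N) \<partial>M)"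
      by (rule NM.expectation_average_mult(2)[OF proc NM.square_integrable_average[OF proc]])
    moreover have "(\<integral>\<omega>. R (Y t \<omega>) * (\<integral>s. R (Y s \<omega>) \<partial>N) \<partial>M) = (\<integral>s. (\<integral>\<omega>. R (Y s \<omega>) * R (Y t \<omega>) \<partial>M) \<partial>N)" for t
      using NM.expectation_average_mult(1)[OF proc proc(2)[of t]] by (simp add: mult.commute)
    ultimately show "integrable N (\<lambda>t. \<integral>s. (\<integral>\<omega>. R (Y s \<omega>) * R (Y t \<omega>) \<partial>M) \<partial>N)" by simp
    show "integrable N (\<lambda>t. \<integral>s. K * (cov (s - t))\<^sup>2 \<partial>N)"
    proof (rule N.integrable_const_bound[of _ K])
      have "\<bar>\<integral>s. K * (cov (s - t))\<^sup>2 \<partial>N\<bar> \<le> K" for t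
      proof -
        have "(\<integral>s. K * (cov (s - t))\<^sup>2 \<partial>N) \<le> (\<integral>s. K * 1 \<partial>N)"
          by (intro integral_mono iC mult_left_mono cov2 K0) simp
        moreover have "0 \<le> (\<integral>s. K * (cov (s - t))\<^sup>2 \<partial>N)"
          using K0 by (intro Bochner_Integration.integral_nonneg) auto
        ultimately show ?thesis by (simp add: N.prob_space)
      qed
      then show "AE t in N. norm (\<integral>s. K * (cov (s - t))\<^sup>2 \<partial>N) \<le> K" by simp
      show "(\<lambda>t. \<integral>s. K * (cov (s - t))\<^sup>2 \<partial>N) \<in> borel_measurable N" by measurable
    qed
    fix t
    have "integrable N (\<lambda>s. \<integral>\<omega>. R (Y s \<omega>) * R (Y t \<omega>) \<partial>M)"
      by (rule NM.expectation_average_mult(2)[OF proc proc(2)])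
    then show "(\<integral>s. (\<integral>\<omega>. R (Y s \<omega>) * R (Y t \<omega>) \<partial>M) \<partial>N) \<le> (\<integral>s. K * (cov (s - t))\<^sup>2 \<partial>N)"
      using corr[of _ t] by (intro integral_mono iC) (auto simp: abs_le_iff)
  qed
  also have "\<dots> = K * (\<integral>t. (\<integral>s. (cov (s - t))\<^sup>2 \<partial>N) \<partial>N)" by simp
  finally show ?thesis by (simp add: K_def)
qed

end

section \<open>The set covariogram\<close>

lemma integral_uniform_measure:
  fixes h :: "'a \<Rightarrow> real"
  assumes W: "W \<in> sets M" "0 < measure M W" and [measurable]: "h \<in> borel_measurable M"
  shows "(\<integral>x. h x \<partial>uniform_measure M W) = (LINT x:W|M. h x) / measure M W"
proof -
  have "emeasure M W = ennreal (measure M W)"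
    using W(2) by (intro emeasure_eq_ennreal_measure) (auto simp: measure_def)
  then have "uniform_measure M W = density M (\<lambda>x. ennreal (indicator W x / measure M W))"
    using W unfolding uniform_measure_def
    by (intro density_cong) (auto simp: divide_ennreal indicator_def ennreal_1[symmetric] simp del: ennreal_1)
  also have "(\<integral>x. h x \<partial>\<dots>) = (\<integral>x. (indicator W x / measure M W) *\<^sub>R h x \<partial>M)"
    using W by (intro integral_density) auto
  also have "\<dots> = (LINT x:W|M. h x) / measure M W"
    by (simp add: set_lebesgue_integral_def)
  finally show ?thesis .
qed

text \<open>Substitute \<open>s = t + z\<close> and integrate over \<open>t\<close> first: the points \<open>t\<close> with \<open>t \<in> W\<close> and \<open>t + z \<in> W\<close> form the set
  whose volume is the covariogram at \<open>z\<close>. The substitution is stated for the uniform law on \<open>W\<close>, which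
  accounts for the squared volume.\<close>

lemma integral_set_covariogram:
  fixes h :: "real ^ 'd \<Rightarrow> real"
  assumes W [measurable]: "W \<in> sets borel" and fin: "emeasure lborel W < \<infinity>" and pos: "0 < measure lborel W"
    and [measurable]: "h \<in> borel_measurable borel" and B: "\<And>z. \<bar>h z\<bar> \<le> B"
  shows "(\<integral>z. h z * set_covariogram W z \<partial>lborel)
     = (measure lborel W)\<^sup>2 * (\<integral>t. (\<integral>s. h (s - t) \<partial>uniform_measure lborel W) \<partial>uniform_measure lborel W)"
proof -
  let ?N = "uniform_measure (lborel :: (real ^ 'd) measure) W" and ?w = "measure lborel W"
  define F where "F t z = indicator W t * indicator W (t + z) * h z" for t z :: "real ^ 'd"
  have [measurable]: "(\<lambda>(t, z). F t z) \<in> borel_measurable (lborel \<Otimes>\<^sub>M lborel)"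
    unfolding F_def by measurable
  have B0: "0 \<le> B" using B[of 0] by linarith
  have shift: "(\<integral>z. g (t + z) \<partial>lborel) = (\<integral>s. g s \<partial>lborel)"
    if [measurable]: "g \<in> borel_measurable borel" for g :: "real ^ 'd \<Rightarrow> real" and t
    by (subst (2) lborel_distr_plus[of t, symmetric]) (simp add: integral_distr)
  have iW: "integrable lborel (\<lambda>z. indicator W (t + z) :: real)" for t
  proof -
    have "integrable (distr lborel borel ((+) t)) (indicator W :: _ \<Rightarrow> real)"
      unfolding lborel_distr_plus using fin by simp
    then show ?thesis by (subst (asm) integrable_distr_eq) auto
  qed
  have int: "integrable (lborel \<Otimes>\<^sub>M lborel) (\<lambda>(t, z). F t z)"
  proof (rule lborel_pair.Fubini_integrable)
    have iF: "integrable lborel (F t)" for t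
      using B B0 by (intro Bochner_Integration.integrable_bound[OF integrable_mult_right[OF iW, of B t]])
        (auto simp: F_def[abs_def] abs_mult indicator_def)
    then show "AE t in lborel. integrable lborel (\<lambda>z. case (t, z) of (t, z) \<Rightarrow> F t z)" by simp
    have le: "(\<integral>z. \<bar>F t z\<bar> \<partial>lborel) \<le> B * ?w * indicator W t" for t
    proof -
      have "(\<integral>z. \<bar>F t z\<bar> \<partial>lborel) \<le> (\<integral>z. (B * indicator W t) * indicator W (t + z) \<partial>lborel)"
        using B B0 by (intro integral_mono integrable_abs iF integrable_mult_right iW)
          (auto simp: F_def abs_mult indicator_def)
      also have "\<dots> = B * ?w * indicator W t"
        using shift[of "indicator W" t] by simp
      finally show ?thesis .
    qed
    show "integrable lborel (\<lambda>t. \<integral>z. norm (case (t, z) of (t, z) \<Rightarrow> F t z) \<partial>lborel)"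
    proof (rule Bochner_Integration.integrable_bound)
      show "integrable lborel (\<lambda>t. B * ?w * indicator W t)" using fin by simp
      show "AE t in lborel. norm (\<integral>z. norm (case (t, z) of (t, z) \<Rightarrow> F t z) \<partial>lborel) \<le> norm (B * ?w * indicator W t)"
        by (intro AE_I2) (simp add: order_trans[OF le abs_ge_self])
    qed measurable
  qed measurable
  have "(\<integral>t. (\<integral>s. h (s - t) \<partial>?N) \<partial>?N) = (\<integral>t. (LINT s:W|lborel. h (s - t)) / ?w \<partial>?N)"
    using pos by (simp add: integral_uniform_measure)
  also have "\<dots> = (LINT t:W|lborel. (LINT s:W|lborel. h (s - t))) / ?w\<^sup>2"
    using pos by (subst integral_uniform_measure) (auto simp: set_lebesgue_integral_def power2_eq_square)
  also have "(LINT t:W|lborel. (LINT s:W|lborel. h (s - t))) = (\<integral>t. (\<integral>z. F t z \<partial>lborel) \<partial>lborel)"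
    unfolding set_lebesgue_integral_def
  proof (intro Bochner_Integration.integral_cong refl)
    fix t
    show "indicator W t *\<^sub>R (\<integral>s. indicator W s *\<^sub>R h (s - t) \<partial>lborel) = (\<integral>z. F t z \<partial>lborel)"
      using shift[of "\<lambda>s. indicator W s * h (s - t)" t] by (simp add: F_def mult.assoc)
  qed
  also have "\<dots> = (\<integral>z. (\<integral>t. F t z \<partial>lborel) \<partial>lborel)"
    by (rule lborel_pair.Fubini_integral[OF int, symmetric])
  also have "\<dots> = (\<integral>z. h z * set_covariogram W z \<partial>lborel)"
  proof (intro Bochner_Integration.integral_cong refl)
    fix z :: "real ^ 'd"
    have eq: "W \<inter> (\<lambda>x. x - z) ` W = {t \<in> space lborel. t \<in> W \<and> t + z \<in> W}"
      by (force simp: image_iff intro: bexI[of _ "_ + z"])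
    have [measurable]: "W \<inter> (\<lambda>x. x - z) ` W \<in> sets lborel"
      unfolding eq by measurable
    have "F t z = h z * indicator (W \<inter> (\<lambda>x. x - z) ` W) t" for t
      unfolding eq by (auto simp: F_def indicator_def)
    then show "(\<integral>t. F t z \<partial>lborel) = h z * set_covariogram W z"
      by (simp add: set_covariogram_def)
  qed
  finally show ?thesis using pos by simp
qed

section \<open>The central limit theorem for excursion volumes\<close>

lemma std_normal_integral_eq:
  fixes h :: "real \<Rightarrow> real"
  assumes [measurable]: "h \<in> borel_measurable borel"
  shows "(\<integral>x. h x \<partial>std_normal_distribution) = (\<integral>x. h x * std_normal_density x \<partial>lborel)"
  by (subst integral_density) (auto simp: mult.commute)

context std_gaussian_field
begin

text \<open>Quantitative form for one sampling law \<open>N\<close>: after division by \<open>c * sqrt v\<close> the linear part \<open>G\<close> is exactly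
  standard normal, and \<open>T\<close> differs from it by the normalised average of \<open>R\<close>.\<close>

lemma averaged_indicator_iexp:
  assumes N: "prob_space N" and sN: "sets N = sets borel" and A: "A \<in> sets borel"
    and c: "c = gauss_inner hermite1 (indicator A)" "c \<noteq> 0"
    and v: "v = (\<integral>t. (\<integral>s. cov (s - t) \<partial>N) \<partial>N)" "0 < v"
    and k: "k = (\<integral>t. (\<integral>s. (cov (s - t))\<^sup>2 \<partial>N) \<partial>N)"
    and p: "p = measure std_normal_distribution A"
    and T: "\<And>\<omega>. T \<omega> = ((\<integral>t. indicator A (Y t \<omega>) \<partial>N) - p) / (c * sqrt v)"
  shows "norm ((\<integral>\<omega>. iexp (\<theta> * T \<omega>) \<partial>M) - complex_of_real (exp (- \<theta>\<^sup>2 / 2)))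
     \<le> \<bar>\<theta>\<bar> * sqrt ((\<integral>x. (indicator A x - p - c * x)\<^sup>2 \<partial>std_normal_distribution) / c\<^sup>2 * (k / v))"
proof -
  interpret N: prob_space N by (rule N)
  interpret NM: pair_prob_space N M ..
  note [measurable] = A pair_measurable[OF sN]
  define R where "R x = indicator A x - p - c * x" for x :: real
  define K where "K = (\<integral>x. (R x)\<^sup>2 \<partial>std_normal_distribution)"
  have int_ind: "integrable std_normal_distribution (indicator A :: _ \<Rightarrow> real)"
    by (intro std_normal.integrable_const_bound[of _ 1]) (auto simp: indicator_def)
  have int_x: "integrable std_normal_distribution (\<lambda>x. x)"
    by (rule std_normal.square_integrable_integrable[OF square_integrable_std_normal_id])
  have int_x2: "integrable std_normal_distribution (\<lambda>x::real. x * x)"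
    using square_integrable_mult[OF square_integrable_std_normal_id square_integrable_std_normal_id] .
  have int_xind: "integrable std_normal_distribution (\<lambda>x. x * indicator A x)"
    by (rule square_integrable_mult[OF square_integrable_std_normal_id])
       (auto intro!: std_normal.square_integrable_bounded[of _ 1] simp: indicator_def)
  have m1: "(\<integral>x. x \<partial>std_normal_distribution) = (0::real)"
    using integral_std_normal_distribution_moment_odd[of 1] by simp
  have m2: "(\<integral>x. x * x \<partial>std_normal_distribution) = (1::real)"
    using std_normal_distribution_even_moments(1)[of 1] by (simp add: power2_eq_square)
  have mc: "(\<integral>x. x * indicator A x \<partial>std_normal_distribution) = c"
    unfolding c gauss_inner_def hermite1_def by (rule std_normal_integral_eq) measurable
  have R: "trig_approximable R"
  proof -
    have "trig_approximable (\<lambda>x. indicator A x + ((- p) + (- c) * x))"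
      by (rule trig_approximable_add[OF trig_approximable_indicator[OF A]
            trig_approximable_add[OF trig_approximable_trig_polynomial[OF trig_polynomial_const]
              trig_approximable_cmult[OF trig_approximable_id]]])
    then show ?thesis by (simp add: R_def[abs_def] algebra_simps)
  qed
  have R0: "(\<integral>x. R x \<partial>std_normal_distribution) = 0"
  proof -
    have "measure std_normal_distribution UNIV = 1" using std_normal.prob_space by simp
    then show ?thesis
      unfolding R_def using int_ind int_x by (simp add: m1 p)
  qed
  have R1: "(\<integral>x. x * R x \<partial>std_normal_distribution) = 0"
  proof -
    have "(\<integral>x. x * R x \<partial>std_normal_distribution)
        = (\<integral>x. x * indicator A x - p * x - c * (x * x) \<partial>std_normal_distribution)"
      by (intro Bochner_Integration.integral_cong) (auto simp: R_def algebra_simps)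
    also have "\<dots> = c - p * 0 - c * 1"
      using int_xind int_x int_x2 by (simp add: mc m1 m2)
    finally show ?thesis by simp
  qed
  define G where "G \<omega> = (\<integral>t. Y t \<omega> \<partial>N) / sqrt v" for \<omega>
  note avg = average_gaussian[OF N sN]
  have sG: "square_integrable M G"
    using square_integrable_cmult[OF avg(1), of "1 / sqrt v"] by (simp add: G_def[abs_def])
  have chG: "(\<integral>\<omega>. iexp (\<theta> * G \<omega>) \<partial>M) = complex_of_real (exp (- \<theta>\<^sup>2 / 2))"
  proof -
    have "(\<integral>\<omega>. iexp (\<theta> * G \<omega>) \<partial>M) = (\<integral>\<omega>. iexp ((\<theta> / sqrt v) * (\<integral>t. Y t \<omega> \<partial>N)) \<partial>M)"
      by (simp add: G_def)
    also have "\<dots> = complex_of_real (exp (- (\<theta> / sqrt v)\<^sup>2 * v / 2))"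
      unfolding avg(3) v(1) ..
    also have "- (\<theta> / sqrt v)\<^sup>2 * v / 2 = - \<theta>\<^sup>2 / 2"
      using v(2) by (simp add: power_divide)
    finally show ?thesis .
  qed
  have ind_meas: "(\<lambda>\<omega>. \<integral>t. indicator A (Y t \<omega>) \<partial>N :: real) \<in> borel_measurable M"
    by measurable
  have ind_bound: "0 \<le> (\<integral>t. indicator A (Y t \<omega>) \<partial>N :: real)" "(\<integral>t. indicator A (Y t \<omega>) \<partial>N :: real) \<le> 1"
    if "\<omega> \<in> space M" for \<omega>
  proof -
    show "0 \<le> (\<integral>t. indicator A (Y t \<omega>) \<partial>N :: real)" by simp
    have "(\<integral>t. indicator A (Y t \<omega>) \<partial>N :: real) \<le> (\<integral>t. 1 \<partial>N)"
      using that by (intro integral_mono N.integrable_const_bound[of _ 1]) (auto simp: indicator_def)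
    then show "(\<integral>t. indicator A (Y t \<omega>) \<partial>N :: real) \<le> 1" by (simp add: N.prob_space)
  qed
  have sI: "square_integrable M (\<lambda>\<omega>. \<integral>t. indicator A (Y t \<omega>) \<partial>N)"
    unfolding square_integrable_def
    using ind_meas ind_bound by (intro conjI integrable_const_bound[of _ 1]) (auto intro!: power_le_one)
  have T_eq: "T = (\<lambda>\<omega>. 1 / (c * sqrt v) * ((\<integral>t. indicator A (Y t \<omega>) \<partial>N) - p))"
    by (rule ext) (simp add: T)
  have sT: "square_integrable M T"
    unfolding T_eq by (rule square_integrable_cmult[OF square_integrable_diff[OF sI square_integrable_const]])
  \<comment> \<open>The decomposition may be averaged along every path that is integrable over the sampling law,
    hence almost surely.\<close>
  have AE_eq: "AE \<omega> in M. (T \<omega> - G \<omega>)\<^sup>2 = (\<integral>t. R (Y t \<omega>) \<partial>N)\<^sup>2 / (c\<^sup>2 * v)"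
  proof -
    have "integrable (N \<Otimes>\<^sub>M M) (\<lambda>(t, \<omega>). Y t \<omega>)"
      by (rule NM.square_integrable_integrable[OF
            NM.square_integrable_process[OF pair_measurable[OF sN] Y_square_integrable variance_Y[THEN eq_refl]]])
    from NM.AE_integrable_snd[OF this] AE_space show ?thesis
    proof eventually_elim
      case (elim \<omega>)
      have i: "integrable N (\<lambda>t. indicator A (Y t \<omega>) :: real)"
        using elim(2) by (intro N.integrable_const_bound[of _ 1]) (auto simp: indicator_def)
      have "(\<integral>t. R (Y t \<omega>) \<partial>N) = (\<integral>t. indicator A (Y t \<omega>) \<partial>N) - p - c * (\<integral>t. Y t \<omega> \<partial>N)"
        unfolding R_def using i elim(1) by (simp add: N.prob_space)
      moreover have "G \<omega> = c * (\<integral>t. Y t \<omega> \<partial>N) / (c * sqrt v)"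
        using c(2) by (simp add: G_def)
      ultimately have "T \<omega> - G \<omega> = (\<integral>t. R (Y t \<omega>) \<partial>N) / (c * sqrt v)"
        by (simp only: T diff_divide_distrib)
      then show ?case
        using v(2) by (simp add: power_divide power_mult_distrib)
    qed
  qed
  have "norm ((\<integral>\<omega>. iexp (\<theta> * T \<omega>) \<partial>M) - complex_of_real (exp (- \<theta>\<^sup>2 / 2)))
      \<le> \<bar>\<theta>\<bar> * sqrt (\<integral>\<omega>. (T \<omega> - G \<omega>)\<^sup>2 \<partial>M)"
    unfolding chG[symmetric] by (rule norm_expectation_iexp_diff_le[OF sT sG])
  also have "(\<integral>\<omega>. (T \<omega> - G \<omega>)\<^sup>2 \<partial>M) = (\<integral>\<omega>. (\<integral>t. R (Y t \<omega>) \<partial>N)\<^sup>2 / (c\<^sup>2 * v) \<partial>M)"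
  proof (rule integral_cong_AE)
    show "(\<lambda>\<omega>. (T \<omega> - G \<omega>)\<^sup>2) \<in> borel_measurable M"
      by (intro borel_measurable_power borel_measurable_diff square_integrable_measurable sT sG)
    have [measurable]: "R \<in> borel_measurable borel" unfolding R_def by measurable
    show "(\<lambda>\<omega>. (\<integral>t. R (Y t \<omega>) \<partial>N)\<^sup>2 / (c\<^sup>2 * v)) \<in> borel_measurable M" by measurable
  qed (rule AE_eq)
  also have "\<dots> \<le> K / c\<^sup>2 * (k / v)"
    using divide_right_mono[OF average_hermite_rank_2_bound[OF N sN R R0 R1], of "c\<^sup>2 * v"] v(2)
    by (simp add: K_def k)
  finally show ?thesis
    unfolding K_def R_def by (simp add: mult_left_mono)
qed

lemma set_integral_measurable:
  assumes [measurable]: "W \<in> sets borel" "A \<in> sets borel"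
  shows "(\<lambda>\<omega>. LINT t:W|lborel. indicator A (Y t \<omega>) :: real) \<in> borel_measurable M"
proof -
  have [measurable]: "(\<lambda>(t, \<omega>). Y t \<omega>) \<in> borel_measurable (lborel \<Otimes>\<^sub>M M)"
    by (rule pair_measurable) simp
  interpret pair_sigma_finite lborel M ..
  show ?thesis unfolding set_lebesgue_integral_def by measurable
qed

text \<open>The previous bound for the uniform law on a window, with numerator and denominator multiplied by the
  volume: \<open>sqrt V\<close> is the volume times \<open>sqrt v\<close>, and in the quotient of the two integrals against the covariogram
  the squared volumes cancel. As a variance \<open>v\<close> is nonnegative, so \<open>V \<noteq> 0\<close> means \<open>V > 0\<close>.\<close>

lemma excursion_volume_iexp:
  assumes W: "W \<in> sets borel" "emeasure lborel W < \<infinity>" and w: "0 < measure lborel W"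
    and A: "A \<in> sets borel"
    and c: "c = gauss_inner hermite1 (indicator A)" "c \<noteq> 0"
    and p: "p = measure std_normal_distribution A"
    and V: "V = (\<integral>t. cov t * set_covariogram W t \<partial>lborel)" "V \<noteq> 0"
  shows "norm ((\<integral>\<omega>. iexp (\<theta> * (((LINT t:W|lborel. indicator A (Y t \<omega>)) - measure lborel W * p) / (c * sqrt V))) \<partial>M)
            - complex_of_real (exp (- \<theta>\<^sup>2 / 2)))
     \<le> \<bar>\<theta>\<bar> * sqrt ((\<integral>x. (indicator A x - p - c * x)\<^sup>2 \<partial>std_normal_distribution) / c\<^sup>2
          * ((\<integral>t. (cov t)\<^sup>2 * set_covariogram W t \<partial>lborel) / V))"
proof -
  let ?N = "uniform_measure (lborel :: (real ^ 'd) measure) W" and ?w = "measure lborel W"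
  have N: "prob_space ?N"
    using W w by (intro prob_space_uniform_measure) (auto simp: measure_def)
  have sN: "sets ?N = sets borel" by simp
  define v where "v = (\<integral>t. (\<integral>s. cov (s - t) \<partial>?N) \<partial>?N)"
  define k where "k = (\<integral>t. (\<integral>s. (cov (s - t))\<^sup>2 \<partial>?N) \<partial>?N)"
  have Vv: "V = ?w\<^sup>2 * v"
    unfolding V v_def by (rule integral_set_covariogram[OF W w covariance_measurable covariance_le_1])
  have kk: "(\<integral>t. (cov t)\<^sup>2 * set_covariogram W t \<partial>lborel) = ?w\<^sup>2 * k"
    unfolding k_def
    by (rule integral_set_covariogram[OF W w, of _ 1]) (auto simp: abs_square_le_1 covariance_le_1)
  have "0 \<le> v"
    unfolding v_def average_gaussian(2)[OF N sN, symmetric] by simp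
  then have v0: "0 < v" using Vv V(2) by (cases "v = 0") auto
  have sqrtV: "sqrt V = ?w * sqrt v"
    unfolding Vv using w by (simp add: real_sqrt_mult)
  define T where "T \<omega> = ((\<integral>t. indicator A (Y t \<omega>) \<partial>?N) - p) / (c * sqrt v)" for \<omega>
  have TT: "((LINT t:W|lborel. indicator A (Y t \<omega>)) - ?w * p) / (c * sqrt V) = T \<omega>" if "\<omega> \<in> space M" for \<omega>
  proof -
    have [measurable]: "(\<lambda>(t, \<omega>). Y t \<omega>) \<in> borel_measurable (lborel \<Otimes>\<^sub>M M)"
      by (rule pair_measurable) simp
    have [measurable]: "(\<lambda>t. Y t \<omega>) \<in> borel_measurable lborel" using that by measurable
    have "(\<integral>t. indicator A (Y t \<omega>) \<partial>?N :: real) = (LINT t:W|lborel. indicator A (Y t \<omega>)) / ?w"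
      using A W w by (intro integral_uniform_measure) auto
    then show ?thesis
      unfolding T_def sqrtV using w c(2) v0 by (simp add: field_simps)
  qed
  have "(\<integral>\<omega>. iexp (\<theta> * (((LINT t:W|lborel. indicator A (Y t \<omega>)) - ?w * p) / (c * sqrt V))) \<partial>M)
      = (\<integral>\<omega>. iexp (\<theta> * T \<omega>) \<partial>M)"
    by (intro Bochner_Integration.integral_cong refl) (simp only: TT)
  moreover have "(\<integral>t. (cov t)\<^sup>2 * set_covariogram W t \<partial>lborel) / V = k / v"
    unfolding kk Vv using w by simp
  ultimately show ?thesis
    using averaged_indicator_iexp[OF N sN A c v_def v0 k_def p T_def, of \<theta>] by simp
qed

theorem excursion_volume_clt:
  assumes W: "\<And>n. W n \<in> sets borel" "\<And>n. emeasure lborel (W n) < \<infinity>"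
    and w: "\<forall>\<^sub>F n in sequentially. 0 < measure lborel (W n)"
    and A: "A \<in> sets borel"
    and c: "gauss_inner hermite1 (indicator A) \<noteq> 0"
    and V: "\<forall>\<^sub>F n in sequentially. (\<integral>t. cov t * set_covariogram (W n) t \<partial>lborel) \<noteq> 0"
    and lim: "(\<lambda>n. (\<integral>t. (cov t)\<^sup>2 * set_covariogram (W n) t \<partial>lborel) / (\<integral>t. cov t * set_covariogram (W n) t \<partial>lborel))
               \<longlonglongrightarrow> 0"
  shows "weak_conv_m (\<lambda>n. distr M borel (\<lambda>\<omega>.
      ((LINT t:W n|lborel. indicator A (Y t \<omega>)) - measure lborel (W n) * measure std_normal_distribution A) /
      (gauss_inner hermite1 (indicator A) * sqrt (\<integral>t. cov t * set_covariogram (W n) t \<partial>lborel))))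
    std_normal_distribution"
proof (rule levy_continuity)
  define c p where "c = gauss_inner hermite1 (indicator A)" and "p = measure std_normal_distribution A"
  define V' where "V' n = (\<integral>t. cov t * set_covariogram (W n) t \<partial>lborel)" for n
  define T where "T n \<omega> = ((LINT t:W n|lborel. indicator A (Y t \<omega>)) - measure lborel (W n) * p) / (c * sqrt (V' n))" for n \<omega>
  have T_meas [measurable]: "T n \<in> borel_measurable M" for n
    unfolding T_def using set_integral_measurable[OF W(1) A] by measurable
  show "real_distribution (distr M borel (\<lambda>\<omega>.
      ((LINT t:W n|lborel. indicator A (Y t \<omega>)) - measure lborel (W n) * measure std_normal_distribution A) /
      (gauss_inner hermite1 (indicator A) * sqrt (\<integral>t. cov t * set_covariogram (W n) t \<partial>lborel))))" for n
    using real_distribution_distr[OF T_meas[of n]] unfolding T_def V'_def c_def p_def .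
  show "real_distribution std_normal_distribution" by (rule real_dist_normal_dist)
  fix \<theta> :: real
  have "(\<lambda>n. char (distr M borel (T n)) \<theta>) \<longlonglongrightarrow> char std_normal_distribution \<theta>"
  proof (rule LIM_zero_cancel, rule Lim_null_comparison)
    let ?K = "(\<integral>x. (indicator A x - p - c * x)\<^sup>2 \<partial>std_normal_distribution) / c\<^sup>2"
    let ?r = "\<lambda>n. (\<integral>t. (cov t)\<^sup>2 * set_covariogram (W n) t \<partial>lborel) / V' n"
    show "\<forall>\<^sub>F n in sequentially. norm (char (distr M borel (T n)) \<theta> - char std_normal_distribution \<theta>)
        \<le> \<bar>\<theta>\<bar> * sqrt (?K * ?r n)"
      using w V
    proof eventually_elim
      case (elim n)
      have "char (distr M borel (T n)) \<theta> = (\<integral>\<omega>. iexp (\<theta> * T n \<omega>) \<partial>M)"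
        unfolding char_def by (subst integral_distr) auto
      then show ?case
        unfolding char_std_normal_distribution T_def
        using excursion_volume_iexp[OF W elim(1) A c_def _ p_def V'_def, of \<theta>] elim(2) c
        by (simp add: V'_def c_def)
    qed
    have "(\<lambda>n. \<bar>\<theta>\<bar> * sqrt (?K * ?r n)) \<longlonglongrightarrow> \<bar>\<theta>\<bar> * sqrt (?K * 0)"
      unfolding V'_def by (intro tendsto_intros lim)
    then show "(\<lambda>n. \<bar>\<theta>\<bar> * sqrt (?K * ?r n)) \<longlonglongrightarrow> 0" by simp
  qed
  then show "(\<lambda>n. char (distr M borel (\<lambda>\<omega>.
      ((LINT t:W n|lborel. indicator A (Y t \<omega>)) - measure lborel (W n) * measure std_normal_distribution A) /
      (gauss_inner hermite1 (indicator A) * sqrt (\<integral>t. cov t * set_covariogram (W n) t \<partial>lborel)))) \<theta>)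
    \<longlonglongrightarrow> char std_normal_distribution \<theta>"
    unfolding T_def V'_def c_def p_def .
qed

end

theorem corollary2p4:
  fixes M :: "'w measure"
    and Y X :: "real ^ 'd \<Rightarrow> 'w \<Rightarrow> real"
    and C :: "real ^ 'd \<Rightarrow> real"
    and f :: "real \<Rightarrow> real"
    and u :: real
    and W :: "nat \<Rightarrow> (real ^ 'd) set"
  assumes "prob_space M"
    and "measurable_random_field M Y"
    and "centered_random_field M Y"
    and "stationary_random_field M Y"
    and "gaussian_random_field M Y"
    and "C = covariance_function M Y"
    and "(LINT \<omega>|M. (Y 0 \<omega>)\<^sup>2) = 1"
    and "f \<in> borel_measurable borel"
    and "X = (\<lambda>t \<omega>. f (Y t \<omega>))"
    and "van_hove_sequence W"
    and "gauss_inner hermite1 (indicator {x. f x \<ge> u}) \<noteq> 0"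
    and "\<forall>\<^sub>F n in sequentially. (LINT t|lborel. C t * set_covariogram (W n) t) \<noteq> 0"
    and "(\<lambda>n. (LINT t|lborel. (C t)\<^sup>2 * set_covariogram (W n) t) /
               (LINT t|lborel. C t * set_covariogram (W n) t)) \<longlonglongrightarrow> 0"
  shows "weak_conv_m
    (\<lambda>n. distr M borel (\<lambda>\<omega>.
       ((LINT t:W n|lborel. indicator {u..} (X t \<omega>))
          - measure lborel (W n) * measure M {\<omega> \<in> space M. X 0 \<omega> \<ge> u}) /
       (gauss_inner hermite1 (indicator {x. f x \<ge> u}) *
          sqrt (LINT t|lborel. C t * set_covariogram (W n) t))))
    std_normal_distribution"
proof -
  interpret std_gaussian_field M Y
    by (intro std_gaussian_field.intro std_gaussian_field_axioms.intro assms)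
  let ?A = "{x. u \<le> f x}"
  have A: "?A \<in> sets borel"
    using borel_measurable_le[OF borel_measurable_const assms(8), of u] by simp
  have compact: "compact (W n)" for n
    using assms(10) by (simp add: van_hove_sequence_def)
  have "filterlim (\<lambda>n. measure lborel (W n)) at_top sequentially"
    using assms(10) by (simp add: van_hove_sequence_def)
  then have w: "\<forall>\<^sub>F n in sequentially. 0 < measure lborel (W n)"
    by (simp add: filterlim_at_top_dense)
  have "measure std_normal_distribution ?A = measure (distr M borel (Y 0)) ?A"
    by (simp only: Y_distr)
  also have "\<dots> = measure M {\<omega> \<in> space M. u \<le> X 0 \<omega>}"
    using A by (subst measure_distr) (auto simp: assms(9) intro!: arg_cong[where f="measure M"])
  finally have p: "measure M {\<omega> \<in> space M. u \<le> X 0 \<omega>} = measure std_normal_distribution ?A" ..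
  have ind: "indicator {u..} (X t \<omega>) = (indicator ?A (Y t \<omega>) :: real)" for t \<omega>
    by (simp add: assms(9) indicator_def)
  show ?thesis
    unfolding p ind assms(6)
    by (rule excursion_volume_clt[OF borel_compact[OF compact] emeasure_compact_finite[OF compact] w A
          assms(11-13)[unfolded assms(6)]])
qed

end
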